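(* Let $D$ be a skeletal directed acyclic graph and let $\equiv$ be a congruence of $\mathcal{AR}_D$. Then (1) an acyclic reorientation $E$ of $D$ is minimal in its $\equiv$-class if and only if $\delta_\vee(E)\subseteq\mathbb{I}_\equiv$; (2) the quotient $\mathcal{AR}_D/{\equiv}$ is isomorphic to the subposet of $\mathcal{AR}_D$ induced by $\{E\in\mathcal{AR}_D : \delta_\vee(E)\subseteq\mathbb{I}_\equiv\}$. Symmetrically, $E$ is maximal in its $\equiv$-class if and only if $\delta_\wedge(E)\subseteq\mathbb{I}_\equiv$, and $\mathcal{AR}_D/{\equiv}$ is isomorphic to the subposet of $\mathcal{AR}_D$ induced by $\{E\in\mathcal{AR}_D : \delta_\wedge(E)\subseteq\mathbb{I}_\equiv\}$.
   Context: All directed graphs are finite and simple. A reorientation of a directed acyclic graph $D=(V,A)$ is a directed graph with the same underlying undirected graph, encoded by the set of arcs of $D$ that it reverses. $\mathcal{AR}_D$ is the poset of acyclic reorientations of $D$ ordered by inclusion of sets of reversed arcs. The transitive reduction of a directed acyclic graph is obtained by deleting all arcs whose endpoints are connected by a directed path of length at least $2$. A directed graph is a forest if its underlying undirected graph has no cycle. $D$ is vertebrate if the transitive reduction of every induced subgraph of $D$ is a forest; filled if for any directed path $\pi$ in $D$ whose endpoints are joined by an arc of $D$, all arcs joining any two vertices of $\pi$ belong to $D$; skeletal if vertebrate and filled. When $D$ is skeletal, $\mathcal{AR}_D$ is a lattice. A congruence $\equiv$ of a lattice $L$ is an equivalence relation compatible with meets and joins; the quotient $L/{\equiv}$ is the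 set of classes ordered by $X\le Y$ if $x\le y$ for some $x\in X$, $y\in Y$. A join irreducible $J$ (covering a unique element $J_\star$) is contracted by $\equiv$ if $J_\star\equiv J$, and uncontracted otherwise. The transitive support of an arc $(u,v)$ of $D$ is the set of vertices appearing along directed paths in $D$ from $u$ to $v$. A rope of $D$ is a quadruple $(u,v,\nabla,\Delta)$ where $(u,v)\in A$ and $\nabla\sqcup\Delta$ is a partition of the transitive support of $(u,v)$ minus $\{u,v\}$. For an acyclic reorientation $E$ of $D$ and an arc $(u,v)$ of $D$, let $\nabla_{u,v}^E=\{w\in V : (u,w)\in D\setminus E,\ (w,v)\in D\cap E\}$, $\Delta_{u,v}^E=\{w\in V : (u,w)\in D\cap E,\ (w,v)\in D\setminus E\}$, and $\rho_{u,v}^E=(u,v,\nabla_{u,v}^E,\Delta_{u,v}^E)$. Let $\delta_\vee(E)$ (resp. $\delta_\wedge(E)$) be the set of ropes $\rho_{u,v}^E$ for the arcs $(u,v)$ of $D$ that are reversed (resp. not reversed) in the transitive reduction of $E$, i.e. such that $(v,u)$ (resp. $(u,v)$) is an arc of the transitive reduction of $E$. For a join irreducible $J$ of $\mathcal{AR}_D$, $\delta_\vee(J)$ consists of a single rope $\rho_\vee(J)$, and $J\mapsto\rho_\vee(J)$ is a bijection from the join irreducibles of $\mathcal{AR}_D$ to the ropes of $D$. $\mathbb{I}_\equiv$ denotes the set of ropes $\rho_\vee(J)$ for the join irreducibles $J$ of $\mathcal{AR}_D$ uncontracted by $\equiv$. *)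

theory Defs
  imports "Graph_Theory.Digraph_Component" "Graph_Theory.Vertex_Walk" "HOL-Algebra.Lattice"
begin

section \<open>Directed graphs\<close>

text \<open>In contrast to \<^const>\<open>pair_digraph\<close>, pairs of opposite arcs are excluded as well, so that the
  underlying undirected graph is simple and each of its edges carries exactly one orientation.\<close>

definition simple_digraph :: "'a pair_pre_digraph \<Rightarrow> bool" where
  "simple_digraph D \<longleftrightarrow> pair_digraph D \<and> asym (parcs D)"

definition dag :: "'a pair_pre_digraph \<Rightarrow> bool" where
  "dag D \<longleftrightarrow> simple_digraph D \<and> acyclic (parcs D)"

definition dipath :: "('a, 'b) pre_digraph \<Rightarrow> 'a \<Rightarrow> 'a vwalk \<Rightarrow> 'a \<Rightarrow> bool" where
  "dipath G u p v \<longleftrightarrow> vpath p G \<and> hd p = u \<and> last p = v"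

definition transitive_reduction :: "('a, 'b) pre_digraph \<Rightarrow> ('a, 'b) pre_digraph" where
  "transitive_reduction G =
     G\<lparr>arcs := {e \<in> arcs G. \<not> (\<exists>p. dipath G (tail G e) p (head G e) \<and> 2 \<le> vwalk_length p)}\<rparr>"

text \<open>The constant \<^const>\<open>forest\<close> forbids directed cycles only. Here undirected cycles are
  forbidden: these are the cycles of length at least 3 of the symmetric digraph, as any single edge
  gives rise to a cycle of length 2 in it.\<close>

definition undirected_forest :: "('a, 'b) pre_digraph \<Rightarrow> bool" where
  "undirected_forest G \<longleftrightarrow>
     \<not> (\<exists>p. pre_digraph.cycle (with_proj (mk_symmetric G)) p \<and> 3 \<le> length p)"

definition vertebrate :: "'a pair_pre_digraph \<Rightarrow> bool" where
  "vertebrate D \<longleftrightarrow>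
     (\<forall>H. induced_subgraph H (with_proj D) \<longrightarrow> undirected_forest (transitive_reduction H))"

definition filled :: "'a pair_pre_digraph \<Rightarrow> bool" where
  "filled D \<longleftrightarrow>
     (\<forall>u p v. dipath (with_proj D) u p v \<and> (u, v) \<in> parcs D \<longrightarrow>
        (\<forall>i j. i < j \<and> j < length p \<longrightarrow> (p ! i, p ! j) \<in> parcs D))"

definition skeletal :: "'a pair_pre_digraph \<Rightarrow> bool" where
  "skeletal D \<longleftrightarrow> vertebrate D \<and> filled D"


section \<open>Acyclic reorientations\<close>

definition reorientation :: "'a pair_pre_digraph \<Rightarrow> 'a pair_pre_digraph \<Rightarrow> bool" where
  "reorientation D E \<longleftrightarrow>
     simple_digraph E \<and> mk_symmetric (with_proj E) = mk_symmetric (with_proj D)"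

definition reversed_arcs :: "'a pair_pre_digraph \<Rightarrow> 'a pair_pre_digraph \<Rightarrow> ('a \<times> 'a) set" where
  "reversed_arcs D E = {(u, v) \<in> parcs D. (v, u) \<in> parcs E}"

definition AR :: "'a pair_pre_digraph \<Rightarrow> 'a pair_pre_digraph gorder" where
  "AR D = \<lparr>carrier = {E. reorientation D E \<and> acyclic (parcs E)},
           eq = (=),
           le = (\<lambda>E F. reversed_arcs D E \<subseteq> reversed_arcs D F)\<rparr>"


section \<open>Posets and lattice congruences\<close>

definition subposet :: "'a gorder \<Rightarrow> 'a set \<Rightarrow> 'a gorder" where
  "subposet L S = L\<lparr>carrier := carrier L \<inter> S\<rparr>"

definition poset_isomorphic :: "'a gorder \<Rightarrow> 'b gorder \<Rightarrow> bool" where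
  "poset_isomorphic P Q \<longleftrightarrow> (\<exists>f. order_emb P Q f \<and> bij_betw f (carrier P) (carrier Q))"

definition lattice_congruence :: "'a gorder \<Rightarrow> ('a \<times> 'a) set \<Rightarrow> bool" where
  "lattice_congruence L r \<longleftrightarrow>
     equiv (carrier L) r \<and>
     (\<forall>(x, x') \<in> r. \<forall>(y, y') \<in> r.
        (x \<squnion>\<^bsub>L\<^esub> y, x' \<squnion>\<^bsub>L\<^esub> y') \<in> r \<and> (x \<sqinter>\<^bsub>L\<^esub> y, x' \<sqinter>\<^bsub>L\<^esub> y') \<in> r)"

definition quotient_poset :: "'a gorder \<Rightarrow> ('a \<times> 'a) set \<Rightarrow> 'a set gorder" where
  "quotient_poset L r =
     \<lparr>carrier = carrier L // r, eq = (=), le = (\<lambda>X Y. \<exists>x\<in>X. \<exists>y\<in>Y. x \<sqsubseteq>\<^bsub>L\<^esub> y)\<rparr>"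

definition minimal_in_class :: "'a gorder \<Rightarrow> ('a \<times> 'a) set \<Rightarrow> 'a \<Rightarrow> bool" where
  "minimal_in_class L r x \<longleftrightarrow> \<not> (\<exists>y \<in> r `` {x}. y \<sqsubset>\<^bsub>L\<^esub> x)"

definition maximal_in_class :: "'a gorder \<Rightarrow> ('a \<times> 'a) set \<Rightarrow> 'a \<Rightarrow> bool" where
  "maximal_in_class L r x \<longleftrightarrow> \<not> (\<exists>y \<in> r `` {x}. x \<sqsubset>\<^bsub>L\<^esub> y)"

definition covers :: "'a gorder \<Rightarrow> 'a \<Rightarrow> 'a \<Rightarrow> bool" where
  "covers L y x \<longleftrightarrow>
     x \<in> carrier L \<and> y \<in> carrier L \<and> x \<sqsubset>\<^bsub>L\<^esub> y \<and>
     \<not> (\<exists>z \<in> carrier L. x \<sqsubset>\<^bsub>L\<^esub> z \<and> z \<sqsubset>\<^bsub>L\<^esub> y)"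

definition join_irreducible :: "'a gorder \<Rightarrow> 'a \<Rightarrow> bool" where
  "join_irreducible L J \<longleftrightarrow> J \<in> carrier L \<and> (\<exists>!K. covers L J K)"

definition lower_cover :: "'a gorder \<Rightarrow> 'a \<Rightarrow> 'a" where
  "lower_cover L J = (THE K. covers L J K)"

definition contracted :: "'a gorder \<Rightarrow> ('a \<times> 'a) set \<Rightarrow> 'a \<Rightarrow> bool" where
  "contracted L r J \<longleftrightarrow> (lower_cover L J, J) \<in> r"


section \<open>Ropes\<close>

type_synonym 'a rope = "'a \<times> 'a \<times> 'a set \<times> 'a set"

definition transitive_support :: "'a pair_pre_digraph \<Rightarrow> 'a \<Rightarrow> 'a \<Rightarrow> 'a set" where
  "transitive_support D u v = {w. \<exists>p. dipath (with_proj D) u p v \<and> w \<in> set p}"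

definition ropes :: "'a pair_pre_digraph \<Rightarrow> 'a rope set" where
  "ropes D =
     {(u, v, N, T). (u, v) \<in> parcs D \<and> N \<inter> T = {} \<and> N \<union> T = transitive_support D u v - {u, v}}"

definition rope_nabla ::
    "'a pair_pre_digraph \<Rightarrow> 'a pair_pre_digraph \<Rightarrow> 'a \<Rightarrow> 'a \<Rightarrow> 'a set" where
  "rope_nabla D E u v =
     {w \<in> pverts D. (u, w) \<in> parcs D - parcs E \<and> (w, v) \<in> parcs D \<inter> parcs E}"

definition rope_delta ::
    "'a pair_pre_digraph \<Rightarrow> 'a pair_pre_digraph \<Rightarrow> 'a \<Rightarrow> 'a \<Rightarrow> 'a set" where
  "rope_delta D E u v =
     {w \<in> pverts D. (u, w) \<in> parcs D \<inter> parcs E \<and> (w, v) \<in> parcs D - parcs E}"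

definition arc_rope ::
    "'a pair_pre_digraph \<Rightarrow> 'a pair_pre_digraph \<Rightarrow> 'a \<Rightarrow> 'a \<Rightarrow> 'a rope" where
  "arc_rope D E u v = (u, v, rope_nabla D E u v, rope_delta D E u v)"

definition join_ropes :: "'a pair_pre_digraph \<Rightarrow> 'a pair_pre_digraph \<Rightarrow> 'a rope set" where
  "join_ropes D E =
     {arc_rope D E u v | u v.
        (u, v) \<in> parcs D \<and> (v, u) \<in> arcs (transitive_reduction (with_proj E))}"

definition meet_ropes :: "'a pair_pre_digraph \<Rightarrow> 'a pair_pre_digraph \<Rightarrow> 'a rope set" where
  "meet_ropes D E =
     {arc_rope D E u v | u v.
        (u, v) \<in> parcs D \<and> (u, v) \<in> arcs (transitive_reduction (with_proj E))}"

text \<open>If \<open>D\<close> is skeletal and \<open>J\<close> is join irreducible in \<open>AR D\<close>, then \<open>join_ropes D J\<close> is a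
  singleton, so that \<^const>\<open>the_elem\<close> is meaningful.\<close>

definition join_rope :: "'a pair_pre_digraph \<Rightarrow> 'a pair_pre_digraph \<Rightarrow> 'a rope" where
  "join_rope D J = the_elem (join_ropes D J)"

definition uncontracted_ropes ::
    "'a pair_pre_digraph \<Rightarrow> ('a pair_pre_digraph \<times> 'a pair_pre_digraph) set \<Rightarrow> 'a rope set" where
  "uncontracted_ropes D r =
     {\<rho> \<in> ropes D. \<exists>J. join_irreducible (AR D) J \<and> \<not> contracted (AR D) r J \<and> \<rho> = join_rope D J}"

end

theory Submission
  imports Defs
begin

text \<open>Acyclic reorientations of a skeletal \<open>D\<close> correspond to the sets \<open>R\<close> of arcs such that neither
  \<open>R\<close> nor its complement breaks transitivity on a triangle of \<open>D\<close>, and the join of \<open>R\<close> and \<open>S\<close> is the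
  set of arcs in the transitive closure of \<open>R \<union> S\<close>; meets follow by complementation. The cover
  relations of the lattice flip one arc of the transitive reduction. The lower cover of \<open>E\<close> that flips
  \<open>(u, v)\<close> is perspective to \<open>(J\<^sub>\<star>, J)\<close>, where \<open>J\<close> is the join irreducible whose rope is that of
  \<open>E\<close> at \<open>(u, v)\<close>, so a congruence contracts the one pair if and only if it contracts the other. An
  element is minimal in its class if and only if none of its lower covers is contracted, and the
  minimal elements represent the quotient. The rope at \<open>(u, v)\<close> does not depend on the orientation of
  that arc, which gives the statement on maximal elements.\<close>

section \<open>Cover arcs of an acyclic relation\<close>

text \<open>For acyclic \<open>E\<close> this is the arc set of the transitive reduction
  (\<open>transitive_reduction_arcs\<close>). Transitive closures replace directed paths, so that
  distinctness of vertices need not be tracked.\<close>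

definition cover_arcs :: "('a \<times> 'a) set \<Rightarrow> ('a \<times> 'a) set" where
  "cover_arcs E = {(a, b) \<in> E. \<nexists>w. (a, w) \<in> E\<^sup>+ \<and> (w, b) \<in> E\<^sup>+}"

lemma cover_arcs_subset: "cover_arcs E \<subseteq> E"
  by (auto simp: cover_arcs_def)

text \<open>Induction on the number of vertices strictly between \<open>a\<close> and
  \<open>b\<close>. With none, \<open>(a, b)\<close> is itself a cover arc; otherwise an
  intermediate \<open>w\<close> splits the pair into two with fewer, as acyclicity keeps
  \<open>w\<close> out of both.\<close>

lemma trancl_cover_arcs:
  assumes "finite E" and "acyclic E"
  shows "(cover_arcs E)\<^sup>+ = E\<^sup>+"
proof
  show "(cover_arcs E)\<^sup>+ \<subseteq> E\<^sup>+"
    by (simp add: cover_arcs_subset trancl_mono_subset)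
  define between where "between a b = {w. (a, w) \<in> E\<^sup>+ \<and> (w, b) \<in> E\<^sup>+}" for a b
  have fin: "finite (between a b)" for a b
  proof (rule finite_subset)
    show "between a b \<subseteq> Range (E\<^sup>+)" unfolding between_def by blast
    show "finite (Range (E\<^sup>+))" using assms(1) by (simp add: finite_Range)
  qed
  have "(a, b) \<in> (cover_arcs E)\<^sup>+" if "(a, b) \<in> E\<^sup>+" for a b
    using that
  proof (induction "card (between a b)" arbitrary: a b rule: less_induct)
    case less
    show ?case
    proof (cases "between a b = {}")
      case True
      have "(a, b) \<in> E"
        using less.prems
      proof (cases rule: tranclE)
        case (step c)
        with True show ?thesis by (auto simp: between_def)
      qed
      with True show ?thesis by (auto simp: between_def cover_arcs_def)
    next
      case False
      then obtain w where w: "(a, w) \<in> E\<^sup>+" "(w, b) \<in> E\<^sup>+" by (auto simp: between_def)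
      have "w \<in> between a b" "w \<notin> between a w" "w \<notin> between w b"
        using w assms(2) by (auto simp: between_def acyclic_def)
      moreover have "between a w \<subseteq> between a b" "between w b \<subseteq> between a b"
        using w by (auto simp: between_def)
      ultimately have "card (between a w) < card (between a b)"
        "card (between w b) < card (between a b)"
        by (auto intro!: psubset_card_mono[OF fin])
      with less.hyps w have "(a, w) \<in> (cover_arcs E)\<^sup>+" "(w, b) \<in> (cover_arcs E)\<^sup>+" by auto
      then show ?thesis by simp
    qed
  qed
  then show "E\<^sup>+ \<subseteq> (cover_arcs E)\<^sup>+" by auto
qed

text \<open>A cycle through the new arc \<open>(b, a)\<close> would contain a path from
  \<open>a\<close> to \<open>b\<close> avoiding the old arc, which would then be redundant. A detour
  around \<open>(b, a)\<close> would close a cycle with \<open>(a, b)\<close> in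
  \<open>E\<close>.\<close>

lemma flip_cover_arc:
  assumes "acyclic E" and ab: "(a, b) \<in> cover_arcs E"
  defines "E' \<equiv> insert (b, a) (E - {(a, b)})"
  shows "acyclic E'" and "(b, a) \<in> cover_arcs E'"
proof -
  let ?E0 = "E - {(a, b)}"
  have mono: "(x, y) \<in> ?E0\<^sup>+ \<Longrightarrow> (x, y) \<in> E\<^sup>+" for x y
    by (erule trancl_mono) auto
  have abE: "(a, b) \<in> E" and no: "(a, w) \<in> E\<^sup>+ \<Longrightarrow> (w, b) \<in> E\<^sup>+ \<Longrightarrow> False" for w
    using ab by (auto simp: cover_arcs_def)
  have ne: "a \<noteq> b" using abE assms(1) by (auto simp: acyclic_def)
  have "(a, b) \<notin> ?E0\<^sup>*"
  proof
    assume "(a, b) \<in> ?E0\<^sup>*"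
    then show False
    proof (cases rule: converse_rtranclE)
      case base with ne show False by simp
    next
      case (step c)
      then have "(c, b) \<in> ?E0\<^sup>+" by (auto simp: rtrancl_eq_or_trancl)
      with step(1) no[of c] mono show False by auto
    qed
  qed
  moreover have "acyclic ?E0" using assms(1) by (rule acyclic_subset) auto
  ultimately show ac: "acyclic E'" by (simp add: E'_def acyclic_insert)
  have "False" if w: "(b, w) \<in> E'\<^sup>+" "(w, a) \<in> E'\<^sup>+" for w
  proof -
    have sub: "(x, y) \<in> ?E0\<^sup>* \<Longrightarrow> (x, y) \<in> E'\<^sup>*" for x y
      by (erule rtrancl_mono[THEN subsetD, rotated]) (auto simp: E'_def)
    have cyc: "(x, y) \<in> E'\<^sup>+ \<Longrightarrow> (y, x) \<in> E'\<^sup>* \<Longrightarrow> False" for x y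
      using ac by (meson acyclic_def trancl_rtrancl_trancl)
    \<comment> \<open>Each walk either stays in \<open>?E0\<close> or uses the new arc
      \<open>(b, a)\<close>; the latter closes a cycle in \<open>E'\<close> with the other
      walk.\<close>
    have "(b, w) \<in> ?E0\<^sup>+ \<or> (a, w) \<in> ?E0\<^sup>*" "(w, a) \<in> ?E0\<^sup>+ \<or> (w, b) \<in> ?E0\<^sup>*"
      using w unfolding E'_def trancl_insert by auto
    with sub cyc w have "(b, w) \<in> ?E0\<^sup>+" "(w, a) \<in> ?E0\<^sup>+" by blast+
    then have "(b, a) \<in> E\<^sup>+" using mono by (blast intro: trancl_trans)
    with abE show False using assms(1) by (meson acyclic_def trancl_into_trancl)
  qed
  then show "(b, a) \<in> cover_arcs E'" by (auto simp: cover_arcs_def E'_def)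
qed


section \<open>Paths, transitive reductions and cycles\<close>

lemma set_vwalk_arcs_nth: "set (vwalk_arcs p) = {(p ! i, p ! Suc i) | i. Suc i < length p}"
proof (induction p rule: vwalk_arcs.induct)
  case (3 x y xs)
  show ?case (is "_ = ?R")
  proof -
    have "?R = insert (x, y) {((y # xs) ! i, (y # xs) ! Suc i) | i. Suc i < length (y # xs)}"
      (is "_ = ?S")
    proof
      show "?R \<subseteq> ?S"
      proof
        fix e assume "e \<in> ?R"
        then obtain i where "e = ((x # y # xs) ! i, (y # xs) ! i)" "i < length (y # xs)" by auto
        then show "e \<in> ?S" by (cases i) auto
      qed
      show "?S \<subseteq> ?R" by force
    qed
    with 3 show ?thesis by simp
  qed
qed auto

lemma vwalk_nth_trancl:
  assumes "vwalk p G" and "i < j" and "j < length p"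
  shows "(p ! i, p ! j) \<in> (arcs_ends G)\<^sup>+"
  using assms(2,3)
proof (induction j)
  case (Suc j)
  then have "(p ! j, p ! Suc j) \<in> arcs_ends G"
    using assms(1) by (auto simp: vwalk_def set_vwalk_arcs_nth)
  with Suc show ?case by (cases "i = j") auto
qed simp

text \<open>The concatenation of two walks is a path here, because a repeated vertex would close a
  directed cycle. The bounds on \<open>k\<close> record that \<open>w\<close> is an interior
  vertex.\<close>

lemma acyclic_dipath_through:
  assumes "acyclic (arcs_ends G)" and "arcs_ends G \<subseteq> verts G \<times> verts G"
    and "(a, w) \<in> (arcs_ends G)\<^sup>+" and "(w, b) \<in> (arcs_ends G)\<^sup>+"
  obtains p k where "dipath G a p b" "0 < k" "Suc k < length p" "p ! k = w"
proof -
  let ?E = "arcs_ends G"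
  obtain n f where f: "f 0 = a" "f n = w" "\<And>i. i < n \<Longrightarrow> (f i, f (Suc i)) \<in> ?E" "n > 0"
    using assms(3) unfolding trancl_power relpow_fun_conv by blast
  obtain m g where g: "g 0 = w" "g m = b" "\<And>i. i < m \<Longrightarrow> (g i, g (Suc i)) \<in> ?E" "m > 0"
    using assms(4) unfolding trancl_power relpow_fun_conv by blast
  define h where "h i = (if i \<le> n then f i else g (i - n))" for i
  have h: "h 0 = a" "h n = w" "h (n + m) = b" using f g by (auto simp: h_def)
  have step: "(h i, h (Suc i)) \<in> ?E" if "i < n + m" for i
  proof -
    consider "i < n" | "i = n" | "i > n" by linarith
    then show ?thesis
    proof cases
      case 2
      with f(2) g(1,4) g(3)[of 0] show ?thesis by (simp add: h_def)
    next
      case 3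
      with that g(3)[of "i - n"] show ?thesis by (simp add: h_def Suc_diff_le)
    qed (use f(3) in \<open>simp add: h_def\<close>)
  qed
  define p where "p = map h [0..<Suc (n + m)]"
  have len: "length p = Suc (n + m)" and nth: "\<And>i. i \<le> n + m \<Longrightarrow> p ! i = h i"
    unfolding p_def by (simp_all del: upt_Suc)
  have "h i \<in> verts G" if "i \<le> n + m" for i
    using step[of "i - 1"] step[of 0] that f(4) assms(2) by (cases i) auto
  then have walk: "vwalk p G"
    using step len by (intro vwalkI) (auto simp: set_vwalk_arcs_nth nth in_set_conv_nth)
  have "p ! i \<noteq> p ! j" if "i < j" "j < length p" for i j
    using vwalk_nth_trancl[OF walk that] assms(1) by (auto simp: acyclic_def)
  then have "distinct p" unfolding distinct_conv_nth by (metis nat_neq_iff)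
  then have "dipath G a p b"
    using walk len nth h unfolding dipath_def
    by (auto simp: hd_conv_nth last_conv_nth simp flip: length_greater_0_conv)
  with that[of p n] show ?thesis using f(4) g(4) len nth h by auto
qed

lemma transitive_reduction_arcs:
  fixes G :: "('a, 'a \<times> 'a) pre_digraph"
  assumes "acyclic (arcs G)" and "arcs G \<subseteq> verts G \<times> verts G" and "tail G = fst" and "head G = snd"
  shows "arcs (transitive_reduction G) = cover_arcs (arcs G)"
proof -
  have ends: "arcs_ends G = arcs G" using assms(3,4) by (auto simp: arcs_ends_def arc_to_ends_def)
  have "(\<exists>p. dipath G a p b \<and> 2 \<le> vwalk_length p) \<longleftrightarrow>
    (\<exists>w. (a, w) \<in> (arcs G)\<^sup>+ \<and> (w, b) \<in> (arcs G)\<^sup>+)" for a b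
  proof
    assume "\<exists>p. dipath G a p b \<and> 2 \<le> vwalk_length p"
    then obtain p where p: "vwalk p G" "hd p = a" "last p = b" "3 \<le> length p"
      by (auto simp: dipath_def)
    then have "a = p ! 0" "b = p ! (length p - 1)"
      by (auto simp: hd_conv_nth last_conv_nth simp flip: length_greater_0_conv)
    with p vwalk_nth_trancl[OF p(1), of 0 1] vwalk_nth_trancl[OF p(1), of 1 "length p - 1"]
    show "\<exists>w. (a, w) \<in> (arcs G)\<^sup>+ \<and> (w, b) \<in> (arcs G)\<^sup>+" by (auto simp: ends)
  next
    assume "\<exists>w. (a, w) \<in> (arcs G)\<^sup>+ \<and> (w, b) \<in> (arcs G)\<^sup>+"
    then obtain w where "(a, w) \<in> (arcs_ends G)\<^sup>+" "(w, b) \<in> (arcs_ends G)\<^sup>+" by (auto simp: ends)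
    then obtain p k where "dipath G a p b" "0 < k" "Suc k < length p"
      using acyclic_dipath_through assms(1,2) ends by metis
    then show "\<exists>p. dipath G a p b \<and> 2 \<le> vwalk_length p" by auto
  qed
  then show ?thesis
    by (auto simp: transitive_reduction_def cover_arcs_def assms(3,4))
qed

text \<open>Bridge from indexed closed vertex sequences to the arc lists used by
  \<open>pre_digraph.cycle\<close>.\<close>

lemma cycle_of_closed_walk:
  fixes G :: "'a pair_pre_digraph"
  assumes "0 < n" and "f n = f 0" and "inj_on f {..<n}"
    and "\<And>i. i < n \<Longrightarrow> (f i, f (Suc i)) \<in> parcs G" and "f 0 \<in> pverts G"
  shows "pre_digraph.cycle (with_proj G) (map (\<lambda>i. (f i, f (Suc i))) [0..<n])"
proof -
  let ?p = "\<lambda>m. map (\<lambda>i. (f i, f (Suc i))) [m..<n]"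
  have cas: "m \<le> n \<Longrightarrow> pcas (f m) (?p m) (f n)" for m
    by (induction m rule: inc_induct) (auto simp: upt_conv_Cons)
  have verts: "m \<le> n \<Longrightarrow> pawalk_verts (f m) (?p m) = map f [m..<Suc n]" for m
    by (induction m rule: inc_induct) (auto simp: upt_conv_Cons simp del: upt_Suc)
  have "tl (pawalk_verts (f 0) (?p 0)) = map f [1..<Suc n]"
    unfolding verts[OF le0] by (simp add: upt_conv_Cons map_tl[symmetric] del: upt_Suc)
  moreover have "inj_on f {1..<Suc n}"
  proof (rule inj_onI)
    fix i j assume ij: "i \<in> {1..<Suc n}" "j \<in> {1..<Suc n}" "f i = f j"
    \<comment> \<open>The tail of the vertex list carries the indices 1 to \<open>n\<close>;
      \<open>c\<close> moves \<open>n\<close> to 0, where injectivity below \<open>n\<close>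
      applies.\<close>
    define c where "c k = (if k = n then 0 else k)" for k
    have "f (c i) = f (c j)" "c i < n" "c j < n" using ij assms(1,2) by (auto simp: c_def)
    then have "c i = c j" using assms(3) by (auto dest: inj_onD)
    with ij show "i = j" by (auto simp: c_def split: if_splits)
  qed
  ultimately have "distinct (tl (pawalk_verts (f 0) (?p 0)))" by (simp add: distinct_map del: upt_Suc)
  moreover have "pre_digraph.awalk (with_proj G) (f 0) (?p 0) (f 0)"
    using cas[of 0] assms by (auto simp: pre_digraph.awalk_def cas_with_proj_eq)
  ultimately show ?thesis
    using assms(1) unfolding pre_digraph.cycle_def awalk_verts_with_proj_eq by auto
qed

text \<open>A cycle of the underlying graph cannot consist of cover arcs of the subgraph induced on
  its own vertices, whose transitive reduction is a forest. Hence some side is bypassed by a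
  directed path through another vertex of the cycle.\<close>

lemma vertebrate_cycle:
  assumes "dag D" and "vertebrate D"
    and n: "3 \<le> n" and "f n = f 0" and "inj_on f {..<n}"
    and adj: "\<And>i. i < n \<Longrightarrow> (f i, f (Suc i)) \<in> parcs D \<or> (f (Suc i), f i) \<in> parcs D"
  obtains i a b w where "i < n" "{a, b} = {f i, f (Suc i)}" "(a, b) \<in> parcs D"
    "w \<in> f ` {..<n}" "(a, w) \<in> (parcs D)\<^sup>+" "(w, b) \<in> (parcs D)\<^sup>+"
proof -
  define S where "S = f ` {..<n}"
  have fS: "f i \<in> S" if "i \<le> n" for i
    using that n assms(4) by (cases "i = n") (auto simp: S_def)
  define A where "A = parcs D \<inter> S \<times> S"
  define H where "H = with_proj \<lparr>pverts = S, parcs = A\<rparr>"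
  interpret D: pair_digraph D using assms(1) by (simp add: dag_def simple_digraph_def)
  have "S \<subseteq> pverts D"
  proof
    fix x assume "x \<in> S"
    then obtain i where "i < n" "x = f i" by (auto simp: S_def)
    with adj[of i] show "x \<in> pverts D" by (auto dest: D.wellformed')
  qed
  have "induced_subgraph H D"
  proof (intro induced_subgraphI subgraphI)
    show "verts H \<subseteq> verts D" using \<open>S \<subseteq> pverts D\<close> by (simp add: H_def)
    show "wf_digraph H" by unfold_locales (auto simp: H_def A_def)
    show "wf_digraph D" by (rule D.wf_digraph)
  qed (auto simp: H_def A_def)
  with assms(2) have forest: "undirected_forest (transitive_reduction H)"
    by (auto simp: vertebrate_def)
  have Asub: "A \<subseteq> parcs D" by (auto simp: A_def)
  have "acyclic A" using assms(1) Asub by (auto simp: dag_def intro: acyclic_subset)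
  then have red: "arcs (transitive_reduction H) = cover_arcs A"
    by (subst transitive_reduction_arcs) (auto simp: H_def A_def)
  have "\<exists>i<n. (f i, f (Suc i)) \<notin> cover_arcs A \<and> (f (Suc i), f i) \<notin> cover_arcs A"
  proof (rule ccontr)
    assume "\<not> ?thesis"
    then have "pre_digraph.cycle (with_proj (mk_symmetric (transitive_reduction H)))
        (map (\<lambda>i. (f i, f (Suc i))) [0..<n])"
      using n assms(4,5) fS[of 0] red
      by (intro cycle_of_closed_walk)
        (force simp: parcs_mk_symmetric transitive_reduction_def H_def)+
    with forest n show False by (auto simp: undirected_forest_def)
  qed
  then obtain i where i: "i < n" "(f i, f (Suc i)) \<notin> cover_arcs A" "(f (Suc i), f i) \<notin> cover_arcs A"
    by blast
  obtain a b where ab: "{a, b} = {f i, f (Suc i)}" "(a, b) \<in> parcs D"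
    using adj[OF i(1)] by blast
  then have "(a, b) \<in> A" "(a, b) \<notin> cover_arcs A"
    using i fS[of i] fS[of "Suc i"] by (auto simp: A_def doubleton_eq_iff)
  then obtain w where w: "(a, w) \<in> A\<^sup>+" "(w, b) \<in> A\<^sup>+" by (auto simp: cover_arcs_def)
  \<comment> \<open>Paths in \<open>A\<close> never leave \<open>S\<close>, so the bypass runs
    through the cycle's own vertices.\<close>
  have "w \<in> S" using w(1) by (auto simp: A_def elim: tranclE)
  show ?thesis
    using that[OF i(1) ab] w \<open>w \<in> S\<close> trancl_mono[OF _ Asub] unfolding S_def by blast
qed

text \<open>Filledness is applied to a path from \<open>u\<close> to \<open>v\<close> through
  \<open>w\<close>, once for the first vertex and \<open>w\<close>, once for \<open>w\<close> and
  the last vertex.\<close>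

lemma filled_between:
  assumes "dag D" and "filled D" and "(u, v) \<in> parcs D"
    and "(u, w) \<in> (parcs D)\<^sup>+" and "(w, v) \<in> (parcs D)\<^sup>+"
  shows "(u, w) \<in> parcs D" and "(w, v) \<in> parcs D"
proof -
  interpret D: pair_digraph D using assms(1) by (simp add: dag_def simple_digraph_def)
  obtain p k where p: "dipath D u p v" "0 < k" "Suc k < length p" "p ! k = w"
    by (rule acyclic_dipath_through[of D u w v])
      (use assms in \<open>auto simp: dag_def dest: D.wellformed'\<close>)
  then have "p ! 0 = u" "p ! (length p - 1) = v"
    by (auto simp: dipath_def hd_conv_nth last_conv_nth simp flip: length_greater_0_conv)
  with p assms(2,3) show "(u, w) \<in> parcs D" "(w, v) \<in> parcs D"
    unfolding filled_def
    by (metis (no_types, lifting) One_nat_def Suc_lessD less_diff_conv2 Suc_leI diff_less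
        length_greater_0_conv less_Suc0 list.size(3) not_less_zero plus_1_eq_Suc Suc_lessE diff_Suc_1)+
qed


section \<open>Biclosed sets of arcs\<close>

definition orient :: "('a \<times> 'a) set \<Rightarrow> ('a \<times> 'a) set \<Rightarrow> ('a \<times> 'a) set" where
  "orient A R = (A - R) \<union> R\<inverse>"

text \<open>The second condition is the first one for the complement \<open>A - R\<close>. For a
  transitive tournament these are the inversion sets of permutations.\<close>

definition biclosed :: "('a \<times> 'a) set \<Rightarrow> ('a \<times> 'a) set \<Rightarrow> bool" where
  "biclosed A R \<longleftrightarrow> R \<subseteq> A \<and>
     (\<forall>u w v. (u, w) \<in> A \<longrightarrow> (w, v) \<in> A \<longrightarrow> (u, v) \<in> A \<longrightarrow>
        ((u, w) \<in> R \<and> (w, v) \<in> R \<longrightarrow> (u, v) \<in> R) \<and>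
        ((u, v) \<in> R \<longrightarrow> (u, w) \<in> R \<or> (w, v) \<in> R))"

lemma biclosedD:
  assumes "biclosed A R" and "(u, w) \<in> A" and "(w, v) \<in> A" and "(u, v) \<in> A"
  shows "(u, w) \<in> R \<Longrightarrow> (w, v) \<in> R \<Longrightarrow> (u, v) \<in> R"
    and "(u, v) \<in> R \<Longrightarrow> (u, w) \<in> R \<or> (w, v) \<in> R"
  using assms unfolding biclosed_def by blast+

lemma biclosed_subset: "biclosed A R \<Longrightarrow> R \<subseteq> A"
  by (simp add: biclosed_def)

text \<open>This symmetry reduces meets to joins.\<close>

lemma biclosed_compl: "biclosed A R \<Longrightarrow> biclosed A (A - R)"
  unfolding biclosed_def by blast

lemma acyclic_no_triangle:
  assumes "acyclic E" and "(a, b) \<in> E" and "(b, c) \<in> E" and "(c, a) \<in> E"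
  shows False
  using assms by (meson acyclic_def r_into_trancl trancl_into_trancl)

lemma acyclic_no_2cycle: "acyclic E \<Longrightarrow> (a, b) \<in> E \<Longrightarrow> (b, a) \<notin> E"
  by (meson acyclic_def r_into_trancl trancl_into_trancl)

text \<open>A violation of either condition turns the triangle \<open>u\<close>, \<open>w\<close>,
  \<open>v\<close> into a directed 3-cycle.\<close>

lemma acyclic_orient_imp_biclosed:
  assumes "R \<subseteq> A" and "acyclic (orient A R)"
  shows "biclosed A R"
  unfolding biclosed_def
proof (intro conjI allI impI)
  fix u w v assume A: "(u, w) \<in> A" "(w, v) \<in> A" "(u, v) \<in> A"
  {
    assume "(u, w) \<in> R \<and> (w, v) \<in> R"
    with A acyclic_no_triangle[OF assms(2), of u v w] show "(u, v) \<in> R" by (auto simp: orient_def)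
  next
    assume "(u, v) \<in> R"
    with A acyclic_no_triangle[OF assms(2), of u w v] show "(u, w) \<in> R \<or> (w, v) \<in> R"
      by (auto simp: orient_def)
  }
qed (rule assms(1))

section \<open>Biclosed sets of a skeletal digraph\<close>

locale skeletal_dag =
  fixes D :: "'a pair_pre_digraph"
  assumes dag: "dag D" and skeletal: "skeletal D"
begin

abbreviation A :: "('a \<times> 'a) set" where "A \<equiv> parcs D"

sublocale D: pair_digraph D
  using dag by (simp add: dag_def simple_digraph_def)

lemma acyclic_A: "acyclic A"
  using dag by (simp add: dag_def)

lemma finite_A: "finite A"
  using D.pair_finite_arcs .

lemma A_asym: "(a, b) \<in> A \<Longrightarrow> (b, a) \<notin> A"
  using acyclic_A by (rule acyclic_no_2cycle)

lemma A_irrefl: "(a, a) \<notin> A"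
  using A_asym by blast

lemma A_between:
  assumes "(u, v) \<in> A" and "(u, w) \<in> A\<^sup>+" and "(w, v) \<in> A\<^sup>+"
  shows "(u, w) \<in> A" and "(w, v) \<in> A"
  using filled_between[OF dag _ assms] skeletal by (auto simp: skeletal_def)

text \<open>Otherwise \<open>u\<close>, \<open>w\<close>, \<open>v\<close>, \<open>x\<close> form a
  4-cycle of the underlying graph. By \<open>vertebrate_cycle\<close> another of its vertices lies
  between the ends of some side, and acyclicity allows this only if \<open>w\<close> and
  \<open>x\<close> are adjacent.\<close>

lemma A_between_adjacent:
  assumes uv: "(u, v) \<in> A" and w: "(u, w) \<in> A" "(w, v) \<in> A" and x: "(u, x) \<in> A" "(x, v) \<in> A"
    and "w \<noteq> x"
  shows "(w, x) \<in> A \<or> (x, w) \<in> A"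
proof (rule ccontr)
  assume na: "\<not> ?thesis"
  define f where "f = (!) [u, w, v, x, u]"
  have f: "f 0 = u" "f (Suc 0) = w" "f 2 = v" "f 3 = x" "f 4 = u" "f (Suc 2) = x" "f (Suc 3) = u"
      "f (Suc (Suc 0)) = v"
    by (simp_all add: f_def eval_nat_numeral)
  have lt4: "i = 0 \<or> i = Suc 0 \<or> i = 2 \<or> i = 3" if "i < 4" for i :: nat using that by auto
  have ne: "u \<noteq> w" "u \<noteq> v" "u \<noteq> x" "w \<noteq> v" "v \<noteq> x" using assms A_irrefl by auto
  have vert: "vertebrate D" using skeletal by (simp add: skeletal_def)
  have inj: "inj_on f {..<4}"
    using ne \<open>w \<noteq> x\<close> by (intro inj_onI) (auto dest!: lt4 simp: f)
  have adj: "(f i, f (Suc i)) \<in> A \<or> (f (Suc i), f i) \<in> A" if "i < 4" for i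
    using lt4[OF that] uv w x by (auto simp: f)
  have "f 4 = f 0" "(3 :: nat) \<le> 4" by (simp_all add: f)
  then obtain i a b y where i: "i < 4" "{a, b} = {f i, f (Suc i)}" "(a, b) \<in> A"
    "y \<in> f ` {..<4}" "(a, y) \<in> A\<^sup>+" "(y, b) \<in> A\<^sup>+"
    using vertebrate_cycle[OF dag vert _ _ inj adj] by metis
  have "(a, y) \<in> A" "(y, b) \<in> A" using A_between i by blast+
  moreover have "y \<in> {u, w, v, x}" using i(4) by (auto dest!: lt4 simp: f)
  moreover have "(a, b) \<in> {(u, w), (w, v), (u, x), (x, v)}"
  proof -
    have "{a, b} \<in> {{u, w}, {w, v}, {v, x}, {x, u}}"
      unfolding i(2) using lt4[OF i(1)] by (elim disjE) (simp_all add: f)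
    then show ?thesis
      by (elim insertE emptyE)
        (use i(3) A_asym[OF w(1)] A_asym[OF w(2)] A_asym[OF x(1)] A_asym[OF x(2)] in
          \<open>simp add: doubleton_eq_iff, blast\<close>)+
  qed
  ultimately show False
    using na A_irrefl A_asym[OF uv] A_asym[OF w(1)] A_asym[OF w(2)] A_asym[OF x(1)] A_asym[OF x(2)]
    by (metis empty_iff insert_iff prod.inject)
qed

text \<open>\<open>A\<close> orders the three vertices linearly, and in each of the six possible
  orders a cyclic orientation violates biclosedness. Supplying all six instances leaves a
  propositional problem.\<close>

lemma biclosed_no_triangle:
  assumes bi: "biclosed A R"
    and "(a, b) \<in> orient A R" "(b, c) \<in> orient A R" "(c, a) \<in> orient A R"
  shows False
proof -
  define X where "X x y \<longleftrightarrow> (x, y) \<in> A" for x y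
  define Y where "Y x y \<longleftrightarrow> (x, y) \<in> R" for x y
  have YX: "Y x y \<Longrightarrow> X x y" for x y
    using biclosed_subset[OF bi] by (auto simp: X_def Y_def)
  have E: "X x y \<and> \<not> Y x y \<or> Y y x" if "(x, y) \<in> orient A R" for x y
    using that by (auto simp: orient_def X_def Y_def)
  have tri: "X x y \<and> X y z \<and> X x z \<longrightarrow>
      \<not> (Y x y \<and> Y y z \<and> \<not> Y x z) \<and> \<not> (\<not> Y x y \<and> \<not> Y y z \<and> Y x z)" for x y z
    using biclosedD[OF bi, of x y z] by (auto simp: X_def Y_def)
  have cyc: "\<not> (X x y \<and> X y z \<and> X z x)" for x y z
    using acyclic_no_triangle[OF acyclic_A, of x y z] by (auto simp: X_def)
  show False
    using E[OF assms(2)] E[OF assms(3)] E[OF assms(4)] YX[of b a] YX[of c b] YX[of a c]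
      cyc[of a b c] cyc[of c b a] tri[of a b c] tri[of b c a] tri[of c a b]
      tri[of c b a] tri[of b a c] tri[of a c b]
    by argo
qed

text \<open>A shortest directed cycle of a reorientation is chordless, so by vertebrateness it is a
  triangle, and biclosed sets are those that avoid cyclic triangles.\<close>

lemma biclosed_imp_acyclic_orient:
  assumes bi: "biclosed A R"
  shows "acyclic (orient A R)"
proof (rule ccontr)
  let ?E = "orient A R"
  note RA = biclosed_subset[OF bi]
  assume "\<not> acyclic ?E"
  then have ex: "\<exists>n>0. \<exists>x. (x, x) \<in> ?E ^^ n" by (auto simp: acyclic_def trancl_power)
  \<comment> \<open>The length of a shortest closed walk.\<close>
  define n where "n = (LEAST n. n > 0 \<and> (\<exists>x. (x, x) \<in> ?E ^^ n))"
  obtain x where n: "n > 0" "(x, x) \<in> ?E ^^ n"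
    using LeastI_ex[OF ex] unfolding n_def by blast
  have short: "n \<le> m" if "(y, y) \<in> ?E ^^ m" "m > 0" for m y
    using that unfolding n_def by (intro Least_le) blast
  obtain f where f: "f 0 = x" "f n = x" "\<And>i. i < n \<Longrightarrow> (f i, f (Suc i)) \<in> ?E"
    using n(2) unfolding relpow_fun_conv by blast
  have path: "(f i, f j) \<in> ?E ^^ (j - i)" if "i \<le> j" "j \<le> n" for i j
    unfolding relpow_fun_conv using that f(3) by (intro exI[of _ "\<lambda>k. f (i + k)"]) auto
  have E_A: "(a, b) \<in> ?E \<Longrightarrow> (a, b) \<in> A \<or> (b, a) \<in> A"
    and A_E: "(a, b) \<in> A \<Longrightarrow> (a, b) \<in> ?E \<or> (b, a) \<in> ?E" for a b
    using RA by (auto simp: orient_def)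
  have E_asym: "(a, b) \<in> ?E \<Longrightarrow> (b, a) \<notin> ?E" for a b
    using RA A_asym by (auto simp: orient_def)
  have inj: "f i \<noteq> f j" if "i < j" "j < n" for i j
    using path[of i j] short[of "f i" "j - i"] that by auto
  \<comment> \<open>Whichever way a chord is oriented, it closes a walk with one of the two parts of
    the cycle. Minimality of \<open>n\<close> then forces it to be a side.\<close>
  have chord: "j = Suc i \<or> i = 0 \<and> Suc j = n"
    if ij: "i < j" "j < n" and "(f i, f j) \<in> A \<or> (f j, f i) \<in> A" for i j
  proof -
    have "(f i, f j) \<in> ?E \<or> (f j, f i) \<in> ?E" using A_E that by blast
    then show ?thesis
    proof
      assume e: "(f i, f j) \<in> ?E"
      have "(f j, f 0) \<in> ?E ^^ (n - j)" "(f 0, f i) \<in> ?E ^^ i"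
        using path[of j n] path[of 0 i] ij f by auto
      with e have "(f j, f j) \<in> ?E ^^ (n - j + i + 1)" by (auto simp: relpow_add)
      then have "n \<le> n - j + i + 1" by (rule short) simp
      with ij show ?thesis by arith
    next
      assume e: "(f j, f i) \<in> ?E"
      have "(f i, f i) \<in> ?E ^^ (Suc (j - i))" using path[of i j] ij e by auto
      then have "n \<le> Suc (j - i)" by (rule short) simp
      with ij show ?thesis by auto
    qed
  qed
  have "n \<noteq> 1" using f(3)[of 0] f(1,2) E_asym[of x x] by auto
  moreover have "n \<noteq> 2" using f(3)[of 0] f(3)[of 1] f(1,2) E_asym by (auto simp: numeral_2_eq_2)
  moreover have "n \<noteq> 3"
  proof
    assume "n = 3"
    then have "(f 0, f 1) \<in> ?E" "(f 1, f 2) \<in> ?E" "(f 2, f 0) \<in> ?E"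
      using f(3)[of 0] f(3)[of 1] f(3)[of 2] f(1,2) by (auto simp: eval_nat_numeral)
    then show False by (rule biclosed_no_triangle[OF bi])
  qed
  ultimately have "4 \<le> n" using n(1) by linarith
  have vert: "vertebrate D" using skeletal by (simp add: skeletal_def)
  have inj_f: "inj_on f {..<n}" using inj by (intro inj_onI) (metis lessThan_iff nat_neq_iff)
  have adj_f: "(f i, f (Suc i)) \<in> A \<or> (f (Suc i), f i) \<in> A" if "i < n" for i
    using f(3)[OF that] E_A by blast
  have "f n = f 0" "3 \<le> n" using f(1,2) \<open>4 \<le> n\<close> by auto
  then obtain i a b w where i: "i < n" "{a, b} = {f i, f (Suc i)}" "(a, b) \<in> A"
    "w \<in> f ` {..<n}" "(a, w) \<in> A\<^sup>+" "(w, b) \<in> A\<^sup>+"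
    using vertebrate_cycle[OF dag vert _ _ inj_f adj_f] by metis
  have aw: "(a, w) \<in> A" "(w, b) \<in> A" using A_between i by blast+
  \<comment> \<open>The cyclic successor of \<open>i\<close>, as an index below
    \<open>n\<close>.\<close>
  define i' where "i' = (if Suc i = n then 0 else Suc i)"
  have i': "i' < n" "f i' = f (Suc i)" using i(1) f(1,2) by (auto simp: i'_def)
  obtain k where k: "k < n" "w = f k" using i(4) by auto
  have adj: "(f p, f q) \<in> A \<or> (f q, f p) \<in> A" if "p \<in> {i, i', k}" "q \<in> {i, i', k}" "p \<noteq> q" for p q
    using that i(2,3) i'(2) aw k(2) by (auto simp: doubleton_eq_iff)
  have "k \<noteq> i" "k \<noteq> i'" using i(2) aw A_irrefl k(2) i'(2) by (auto simp: doubleton_eq_iff)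
  have near: "q = Suc p \<or> p = 0 \<and> Suc q = n" if "p \<in> {i, i', k}" "q \<in> {i, i', k}" "p < q" for p q
    using chord[of p q] adj[of p q] that i(1) i'(1) k(1) by auto
  have i_i': "i' = Suc i \<or> i' = 0 \<and> Suc i = n" by (simp add: i'_def)
  \<comment> \<open>Three distinct positions that are pairwise cyclically consecutive exist only for
    \<open>n = 3\<close>.\<close>
  show False
    using near[of i k] near[of k i] near[of i' k] near[of k i'] i_i' \<open>k \<noteq> i\<close> \<open>k \<noteq> i'\<close> \<open>4 \<le> n\<close>
      k(1) i(1) by auto presburger
qed

lemma biclosed_iff: "biclosed A R \<longleftrightarrow> R \<subseteq> A \<and> acyclic (orient A R)"
  using biclosed_imp_acyclic_orient acyclic_orient_imp_biclosed biclosed_subset by blast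

text \<open>Closure on triangles is transitivity. For the splitting condition, induct on a chain
  from \<open>u\<close> to \<open>v\<close> with last step \<open>(y, v)\<close>: both
  \<open>y\<close> and \<open>w\<close> lie between \<open>u\<close> and \<open>v\<close>, so they
  are equal or adjacent. If \<open>w\<close> precedes \<open>y\<close>, the induction hypothesis
  splits \<open>(u, y)\<close>; if \<open>y\<close> precedes \<open>w\<close>, the arc
  \<open>(y, v)\<close> is split in \<open>R\<close> or \<open>S\<close>.\<close>

lemma biclosed_join:
  assumes R: "biclosed A R" and S: "biclosed A S"
  shows "biclosed A (A \<inter> (R \<union> S)\<^sup>+)"
proof -
  let ?X = "R \<union> S"
  have sub: "?X \<subseteq> A" using R S by (auto dest: biclosed_subset)
  have XA: "(a, b) \<in> ?X\<^sup>+ \<Longrightarrow> (a, b) \<in> A\<^sup>+" for a b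
    using sub by (rule trancl_mono[rotated])
  have split: "(u, w) \<in> ?X\<^sup>+ \<or> (w, v) \<in> ?X\<^sup>+"
    if "(u, v) \<in> ?X\<^sup>+" "(u, v) \<in> A" "(u, w) \<in> A" "(w, v) \<in> A" for u w v
    using that
  proof (induction arbitrary: w rule: trancl_induct)
    case (base v)
    then show ?case using biclosedD(2)[OF R] biclosedD(2)[OF S] by blast
  next
    case (step y v)
    have y: "(u, y) \<in> A" "(y, v) \<in> A"
      using A_between[OF step.prems(1)] XA step.hyps by blast+
    consider "w = y" | "(w, y) \<in> A" | "(y, w) \<in> A"
      using A_between_adjacent[OF step.prems(1) step.prems(2,3) y] by blast
    then show ?case
    proof cases
      case 1
      with step.hyps show ?thesis by blast
    next
      case 2
      with step.IH y step.prems have "(u, w) \<in> ?X\<^sup>+ \<or> (w, y) \<in> ?X\<^sup>+" by blast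
      with step.hyps(2) show ?thesis by (meson trancl_into_trancl)
    next
      case 3
      then have "(y, w) \<in> ?X \<or> (w, v) \<in> ?X"
        using step.hyps(2) biclosedD(2)[OF R] biclosedD(2)[OF S] y step.prems by blast
      with step.hyps(1) show ?thesis by (meson trancl_into_trancl r_into_trancl)
    qed
  qed
  show ?thesis unfolding biclosed_def
    using split by (blast intro: trancl_trans)
qed

text \<open>When a chain in \<open>T\<close> joins the ends of an arc, filledness makes its chords
  from \<open>u\<close> arcs too, so triangle closure of \<open>T\<close> can be applied step by
  step.\<close>

lemma biclosed_join_least:
  assumes T: "biclosed A T" and "R \<subseteq> T" and "S \<subseteq> T"
  shows "A \<inter> (R \<union> S)\<^sup>+ \<subseteq> T"
proof -
  have TA: "T \<subseteq> A" using T by (rule biclosed_subset)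
  have "(u, v) \<in> T" if "(u, v) \<in> T\<^sup>+" "(u, v) \<in> A" for u v
    using that
  proof (induction rule: trancl_induct)
    case (step y v)
    have "(u, y) \<in> A\<^sup>+" "(y, v) \<in> A\<^sup>+" using step.hyps TA trancl_mono by blast+
    then have "(u, y) \<in> A" "(y, v) \<in> A" using A_between step.prems by blast+
    with step biclosedD(1)[OF T] show ?case by blast
  qed
  moreover have "(R \<union> S)\<^sup>+ \<subseteq> T\<^sup>+" using assms by (intro trancl_mono_subset) auto
  ultimately show ?thesis by auto
qed

end


section \<open>Congruences of finite lattices\<close>

lemma poset_isomorphic_inv:
  assumes "poset_isomorphic P Q" and "partial_order P" and "partial_order Q"
  shows "poset_isomorphic (inv_gorder P) (inv_gorder Q)"
proof -
  obtain f where f: "order_emb P Q f" "bij_betw f (carrier P) (carrier Q)"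
    using assms(1) by (auto simp: poset_isomorphic_def)
  have "weak_partial_order (inv_gorder P)" "weak_partial_order (inv_gorder Q)"
    using assms(2,3)[THEN partial_order.dual_order] by (auto simp: partial_order_def)
  with f have "order_emb (inv_gorder P) (inv_gorder Q) f" by (auto simp: order_emb_def)
  with f(2) show ?thesis by (auto simp: poset_isomorphic_def)
qed

lemma subposet_partial_order:
  assumes "partial_order L"
  shows "partial_order (subposet L S)"
proof -
  interpret L: partial_order L by fact
  have "weak_partial_order (subposet L S)"
    unfolding subposet_def by (rule weak_partial_order_subset) (auto intro: L.weak_partial_order_axioms)
  then show ?thesis
    by (auto simp: partial_order_def partial_order_axioms_def subposet_def L.eq_is_equal)
qed

section \<open>Minimal representatives of congruence classes\<close>

locale finite_lattice_congruence = lattice L for L :: "'a gorder" (structure) +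
  fixes r :: "('a \<times> 'a) set"
  assumes finite_carrier: "finite (carrier L)" and congruence: "lattice_congruence L r"
begin

lemma equiv_r: "equiv (carrier L) r"
  using congruence by (simp add: lattice_congruence_def)

lemma r_carrier: "(x, y) \<in> r \<Longrightarrow> x \<in> carrier L \<and> y \<in> carrier L"
  using equiv_r by (auto simp: equiv_def)

lemma r_refl: "x \<in> carrier L \<Longrightarrow> (x, x) \<in> r"
  using equiv_r by (auto simp: equiv_def refl_on_def)

lemma r_sym: "(x, y) \<in> r \<Longrightarrow> (y, x) \<in> r"
  using equiv_r by (auto simp: equiv_def dest: symD)

lemma r_trans: "(x, y) \<in> r \<Longrightarrow> (y, z) \<in> r \<Longrightarrow> (x, z) \<in> r"
  using equiv_r by (auto simp: equiv_def dest: transD)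

lemma r_join: "(x, x') \<in> r \<Longrightarrow> (y, y') \<in> r \<Longrightarrow> (x \<squnion> y, x' \<squnion> y') \<in> r"
  and r_meet: "(x, x') \<in> r \<Longrightarrow> (y, y') \<in> r \<Longrightarrow> (x \<sqinter> y, x' \<sqinter> y') \<in> r"
  using congruence unfolding lattice_congruence_def by blast+

lemma meet_idem: "x \<in> carrier L \<Longrightarrow> x \<sqinter> x = x"
  by (metis le_iff_join le_refl)

lemma meet_absorb: "x \<in> carrier L \<Longrightarrow> y \<in> carrier L \<Longrightarrow> x \<sqsubseteq> y \<Longrightarrow> x \<sqinter> y = x"
  by (metis le_iff_join)

lemma join_absorb: "x \<in> carrier L \<Longrightarrow> y \<in> carrier L \<Longrightarrow> x \<sqsubseteq> y \<Longrightarrow> x \<squnion> y = y"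
  by (metis le_iff_meet)

text \<open>Joining the lower pair with \<open>y\<close> gives the upper pair, and meeting the upper
  pair with \<open>j\<close> gives the lower one back.\<close>

lemma perspective_contracted:
  assumes c: "x \<in> carrier L" "y \<in> carrier L" "j \<in> carrier L" "k \<in> carrier L"
    and "y \<sqsubseteq> x" "j \<sqsubseteq> x" "k \<sqsubseteq> y"
    and j: "y \<squnion> j = x" "y \<sqinter> j = k"
  shows "(k, j) \<in> r \<longleftrightarrow> (y, x) \<in> r"
proof
  assume "(k, j) \<in> r"
  with r_join[OF r_refl[OF c(2)]] have "(y \<squnion> k, y \<squnion> j) \<in> r" by blast
  moreover have "y \<squnion> k = y" using join_absorb[of k y] assms join_comm[of L y k] by simp
  ultimately show "(y, x) \<in> r" using j by simp
next
  assume "(y, x) \<in> r"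
  with r_meet[OF _ r_refl[OF c(3)]] have "(y \<sqinter> j, x \<sqinter> j) \<in> r" by blast
  moreover have "x \<sqinter> j = j" using meet_absorb[of j x] assms meet_comm[of L x j] by simp
  ultimately show "(k, j) \<in> r" using j by simp
qed

text \<open>The meet \<open>x \<sqinter> y\<close> is in the class of \<open>x\<close> and below
  \<open>x\<close>, hence equal to \<open>x\<close>: a minimal element is the least of its
  class.\<close>

lemma minimal_le:
  assumes "minimal_in_class L r x" and "(x, y) \<in> r"
  shows "x \<sqsubseteq> y"
proof -
  have c: "x \<in> carrier L" "y \<in> carrier L" using assms(2) r_carrier by blast+
  have "(x \<sqinter> x, x \<sqinter> y) \<in> r" using assms(2) r_refl c by (blast intro: r_meet)
  then have "(x, x \<sqinter> y) \<in> r" by (simp add: meet_idem c)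
  moreover have "x \<sqinter> y \<sqsubseteq> x" using c by (rule meet_left)
  ultimately have "x \<sqinter> y = x"
    using assms(1) by (auto simp: minimal_in_class_def lless_eq)
  with c show ?thesis by (metis meet_right)
qed

lemma ex_minimal:
  assumes "x \<in> carrier L"
  obtains m where "(x, m) \<in> r" "minimal_in_class L r m"
proof -
  define below where "below y = {z \<in> carrier L. z \<sqsubset> y}" for y
  have "\<exists>m. (x, m) \<in> r \<and> minimal_in_class L r m" if "(x, y) \<in> r" for y
    using that
  proof (induction "card (below y)" arbitrary: y rule: less_induct)
    case less
    show ?case
    proof (cases "minimal_in_class L r y")
      case False
      then obtain z where z: "(y, z) \<in> r" "z \<sqsubset> y" by (auto simp: minimal_in_class_def)
      have c: "y \<in> carrier L" "z \<in> carrier L" using r_carrier z(1) by blast+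
      have "below z \<subseteq> below y" using z(2) c by (auto simp: below_def intro: lless_trans)
      moreover have "z \<in> below y" "z \<notin> below z" using z(2) c by (auto simp: below_def lless_eq)
      moreover have "finite (below y)" using finite_carrier by (simp add: below_def)
      ultimately have "card (below z) < card (below y)" by (blast intro: psubset_card_mono)
      with less z r_trans show ?thesis by blast
    qed (use less.prems in blast)
  qed
  with r_refl[OF assms] that show ?thesis by blast
qed

text \<open>Reads the quotient order off minimal representatives: \<open>x \<sqinter> y\<close> is
  congruent to \<open>x' \<sqinter> y' = x'\<close>, hence to \<open>x\<close>, and so lies above
  \<open>x\<close>.\<close>

lemma class_le_iff:
  assumes "minimal_in_class L r x" "minimal_in_class L r y" "x \<in> carrier L" "y \<in> carrier L"
    and "(x, x') \<in> r" "(y, y') \<in> r" "x' \<sqsubseteq> y'"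
  shows "x \<sqsubseteq> y"
proof -
  have c: "x' \<in> carrier L" "y' \<in> carrier L" using assms r_carrier by blast+
  have "(x \<sqinter> y, x' \<sqinter> y') \<in> r" using assms by (blast intro: r_meet)
  then have "(x, x \<sqinter> y) \<in> r" using c assms by (metis meet_absorb r_sym r_trans)
  then have "x \<sqsubseteq> x \<sqinter> y" by (rule minimal_le[OF assms(1)])
  then show ?thesis
    using assms(3,4) by (meson le_trans meet_closed meet_right)
qed

text \<open>If a congruent \<open>y\<close> below \<open>x\<close> is not a lower cover, some
  \<open>z\<close> lies strictly between them, and joining with \<open>z\<close> shows that
  \<open>z\<close> is congruent to \<open>x\<close>. By finiteness this climb ends at a contracted
  cover.\<close>

lemma minimal_iff_no_contracted_cover:
  assumes x: "x \<in> carrier L"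
  shows "minimal_in_class L r x \<longleftrightarrow> (\<forall>y. covers L x y \<longrightarrow> (y, x) \<notin> r)"
proof
  assume "minimal_in_class L r x"
  then show "\<forall>y. covers L x y \<longrightarrow> (y, x) \<notin> r"
    by (auto simp: minimal_in_class_def covers_def dest: r_sym)
next
  assume nc: "\<forall>y. covers L x y \<longrightarrow> (y, x) \<notin> r"
  define above where "above y = {z \<in> carrier L. y \<sqsubset> z \<and> z \<sqsubset> x}" for y
  have "False" if "(x, y) \<in> r" "y \<sqsubset> x" for y
    using that
  proof (induction "card (above y)" arbitrary: y rule: less_induct)
    case less
    then have y: "y \<in> carrier L" using r_carrier by blast
    have "\<not> covers L x y" using nc less.prems r_sym by blast
    then obtain z where z: "z \<in> carrier L" "y \<sqsubset> z" "z \<sqsubset> x"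
      using less.prems x y by (auto simp: covers_def)
    have "above z \<subseteq> above y" using z y by (auto simp: above_def intro: lless_trans)
    moreover have "z \<in> above y" "z \<notin> above z" using z by (auto simp: above_def lless_eq)
    moreover have "finite (above y)" using finite_carrier by (simp add: above_def)
    ultimately have "card (above z) < card (above y)" by (blast intro: psubset_card_mono)
    moreover have "(x, z) \<in> r"
    proof -
      have "(x \<squnion> z, y \<squnion> z) \<in> r" using less.prems r_refl z(1) by (blast intro: r_join)
      moreover have "y \<squnion> z = z" using y z by (auto intro: join_absorb simp: lless_eq)
      moreover have "x \<squnion> z = x"
        using x z join_absorb[of z x] join_comm[of L x z] by (auto simp: lless_eq)
      ultimately show ?thesis by simp
    qed
    ultimately show False using less.hyps z(3) by blast
  qed
  then show "minimal_in_class L r x" by (auto simp: minimal_in_class_def)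
qed

text \<open>Both claims use one map: \<open>m\<close> picks a minimal member of each class, and by
  \<open>le\<close> the quotient order is pulled back along \<open>m\<close>. Since minimal members
  are least, they are unique in their class, which gives surjectivity.\<close>

lemma quotient_partial_order: "partial_order (quotient_poset L r)"
  and quotient_iso_minimal:
    "poset_isomorphic (quotient_poset L r) (subposet L {x \<in> carrier L. minimal_in_class L r x})"
proof -
  let ?Q = "quotient_poset L r"
  let ?M = "{x \<in> carrier L. minimal_in_class L r x}"
  define m where "m X = (SOME x. x \<in> X \<and> minimal_in_class L r x)" for X
  have m: "m X \<in> X \<and> minimal_in_class L r (m X)" if X: "X \<in> carrier L // r" for X
  proof -
    obtain x where x: "x \<in> carrier L" "X = r `` {x}" using X by (auto simp: quotient_def)
    then obtain y where "(x, y) \<in> r" "minimal_in_class L r y" using ex_minimal by blast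
    with x(2) have "\<exists>x. x \<in> X \<and> minimal_in_class L r x" by auto
    then show ?thesis unfolding m_def by (rule someI_ex)
  qed
  have class_r: "(x, y) \<in> r" if "X \<in> carrier L // r" "x \<in> X" "y \<in> X" for X x y
    using that equiv_r by (auto elim!: quotientE intro: r_sym r_trans)
  have mc: "m X \<in> carrier L" if "X \<in> carrier L // r" for X
    using m[OF that] class_r[OF that] r_carrier by blast
  have le: "X \<sqsubseteq>\<^bsub>?Q\<^esub> Y \<longleftrightarrow> m X \<sqsubseteq> m Y" if "X \<in> carrier L // r" "Y \<in> carrier L // r" for X Y
  proof
    assume "X \<sqsubseteq>\<^bsub>?Q\<^esub> Y"
    then obtain x y where xy: "x \<in> X" "y \<in> Y" "x \<sqsubseteq> y" by (auto simp: quotient_poset_def)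
    have "(m X, x) \<in> r" "(m Y, y) \<in> r" using m class_r that xy(1,2) by simp_all
    with m mc that xy(3) show "m X \<sqsubseteq> m Y" by (metis class_le_iff)
  next
    assume "m X \<sqsubseteq> m Y"
    with m that show "X \<sqsubseteq>\<^bsub>?Q\<^esub> Y" by (auto simp: quotient_poset_def)
  qed
  have inj: "X = Y" if "X \<in> carrier L // r" "Y \<in> carrier L // r" "m X = m Y" for X Y
  proof -
    have "m X \<in> X" "m X \<in> Y" using m[OF that(1)] m[OF that(2)] that(3) by simp_all
    then show ?thesis using quotient_disj[OF equiv_r that(1,2)] by blast
  qed
  have carrier_Q: "carrier ?Q = carrier L // r" and eq_Q: "eq ?Q = (=)"
    by (simp_all add: quotient_poset_def)
  have "weak_partial_order ?Q"
  proof (unfold_locales, unfold carrier_Q eq_Q)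
    fix X Y assume "X \<sqsubseteq>\<^bsub>?Q\<^esub> Y" "Y \<sqsubseteq>\<^bsub>?Q\<^esub> X" and c: "X \<in> carrier L // r" "Y \<in> carrier L // r"
    then have "m X \<sqsubseteq> m Y" "m Y \<sqsubseteq> m X" using le by simp_all
    then have "m X = m Y" using mc[OF c(1)] mc[OF c(2)] by (rule le_antisym)
    with c show "X = Y" by (rule inj)
  next
    fix X Y Z assume "X \<sqsubseteq>\<^bsub>?Q\<^esub> Y" "Y \<sqsubseteq>\<^bsub>?Q\<^esub> Z"
      and c: "X \<in> carrier L // r" "Y \<in> carrier L // r" "Z \<in> carrier L // r"
    then have "m X \<sqsubseteq> m Y" "m Y \<sqsubseteq> m Z" using le by simp_all
    then have "m X \<sqsubseteq> m Z" using mc[OF c(1)] mc[OF c(2)] mc[OF c(3)] by (rule le_trans)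
    then show "X \<sqsubseteq>\<^bsub>?Q\<^esub> Z" using le c by simp
  qed (use le mc in auto)
  then show po: "partial_order ?Q"
    by (auto simp: partial_order_def partial_order_axioms_def quotient_poset_def)
  have "partial_order L" by unfold_locales (rule eq_is_equal)
  then have "partial_order (subposet L ?M)" by (rule subposet_partial_order)
  with po have "order_emb ?Q (subposet L ?M) m"
    using le by (auto simp: order_emb_def partial_order_def carrier_Q subposet_def)
  moreover have "bij_betw m (carrier ?Q) (carrier (subposet L ?M))"
  proof (intro bij_betwI' ballI)
    fix x assume "x \<in> carrier (subposet L ?M)"
    then have x: "x \<in> carrier L" "minimal_in_class L r x" by (auto simp: subposet_def)
    let ?X = "r `` {x}"
    have X: "?X \<in> carrier L // r" using x(1) by (rule quotientI)
    have mX: "(x, m ?X) \<in> r" using m[OF X] by auto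
    then have "x \<sqsubseteq> m ?X" "m ?X \<sqsubseteq> x"
      using minimal_le x(2) m[OF X] r_sym by blast+
    then have "x = m ?X" using x(1) mc[OF X] by (blast intro: le_antisym)
    with X show "\<exists>X\<in>carrier ?Q. x = m X" by (auto simp: carrier_Q)
  qed (use inj m mc in \<open>auto simp: carrier_Q subposet_def\<close>)
  ultimately show "poset_isomorphic ?Q (subposet L ?M)" by (auto simp: poset_isomorphic_def)
qed

section \<open>Duality and maximal representatives\<close>

lemma dual: "finite_lattice_congruence (inv_gorder L) r"
proof -
  interpret dual: lattice "inv_gorder L" by (rule dual_lattice)
  show ?thesis
    by unfold_locales (use finite_carrier congruence in \<open>auto simp: lattice_congruence_def\<close>)
qed

lemma lless_inv: "x \<sqsubset>\<^bsub>inv_gorder L\<^esub> y \<longleftrightarrow> y \<sqsubset> x"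
  by (auto simp: lless_def eq_is_equal)

lemma minimal_inv: "minimal_in_class (inv_gorder L) r x \<longleftrightarrow> maximal_in_class L r x"
  by (simp add: minimal_in_class_def maximal_in_class_def lless_inv)

lemma maximal_iff_no_contracted_cover:
  assumes "x \<in> carrier L"
  shows "maximal_in_class L r x \<longleftrightarrow> (\<forall>y. covers L y x \<longrightarrow> (x, y) \<notin> r)"
proof -
  have "covers (inv_gorder L) x y \<longleftrightarrow> covers L y x" for y
    by (auto simp: covers_def lless_inv)
  moreover have "(x, y) \<in> r \<longleftrightarrow> (y, x) \<in> r" for y using r_sym by blast
  ultimately show ?thesis
    using finite_lattice_congruence.minimal_iff_no_contracted_cover[OF dual, of x] assms
    by (simp add: minimal_inv)
qed

lemma quotient_iso_maximal:
  "poset_isomorphic (quotient_poset L r) (subposet L {x \<in> carrier L. maximal_in_class L r x})"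
proof -
  interpret dual: finite_lattice_congruence "inv_gorder L" r by (rule dual)
  let ?M = "{x \<in> carrier L. maximal_in_class L r x}"
  have "partial_order (inv_gorder L)" by unfold_locales (rule dual.eq_is_equal)
  then have "partial_order (subposet (inv_gorder L) ?M)" by (rule subposet_partial_order)
  with dual.quotient_iso_minimal have
    "poset_isomorphic (inv_gorder (quotient_poset (inv_gorder L) r))
       (inv_gorder (subposet (inv_gorder L) ?M))"
    by (intro poset_isomorphic_inv dual.quotient_partial_order) (simp_all add: minimal_inv)
  \<comment> \<open>The quotient order asks for comparable members of the two classes, a condition
    that commutes with reversing the order.\<close>
  moreover have "inv_gorder (quotient_poset (inv_gorder L) r) = quotient_poset L r"
    by (auto simp: quotient_poset_def fun_eq_iff)
  moreover have "inv_gorder (subposet (inv_gorder L) ?M) = subposet L ?M"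
    by (simp add: subposet_def)
  ultimately show ?thesis by simp
qed

end


section \<open>The lattice of acyclic reorientations\<close>

lemma mk_symmetric_with_proj:
  "mk_symmetric (with_proj G) = \<lparr>pverts = pverts G, parcs = parcs G \<union> (parcs G)\<inverse>\<rparr>"
  by (force simp: mk_symmetric_def)

context skeletal_dag
begin

definition reorient :: "('a \<times> 'a) set \<Rightarrow> 'a pair_pre_digraph" where
  "reorient R = \<lparr>pverts = pverts D, parcs = orient A R\<rparr>"

lemma parcs_reorient [simp]: "parcs (reorient R) = orient A R"
  and pverts_reorient [simp]: "pverts (reorient R) = pverts D"
  by (simp_all add: reorient_def)

lemma orient_diff_iff: "R \<subseteq> A \<Longrightarrow> (u, v) \<in> A - orient A R \<longleftrightarrow> (u, v) \<in> R"
  and orient_inter_iff: "R \<subseteq> A \<Longrightarrow> (u, v) \<in> A \<inter> orient A R \<longleftrightarrow> (u, v) \<in> A - R"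
  and orient_rev_iff: "R \<subseteq> A \<Longrightarrow> (u, v) \<in> A \<Longrightarrow> (v, u) \<in> orient A R \<longleftrightarrow> (u, v) \<in> R"
  using A_asym by (auto simp: orient_def)

lemma reversed_arcs_reorient [simp]:
  assumes "R \<subseteq> A"
  shows "reversed_arcs D (reorient R) = R"
  using assms orient_rev_iff[OF assms] by (auto simp: reversed_arcs_def)

lemma reorient_in_AR:
  assumes "biclosed A R"
  shows "reorient R \<in> carrier (AR D)"
proof -
  note R = biclosed_subset[OF assms]
  have "finite (orient A R)"
    using finite_A R by (auto simp: orient_def intro: finite_subset)
  moreover have "orient A R \<subseteq> pverts D \<times> pverts D"
    using R by (auto simp: orient_def dest: D.wellformed')
  moreover have asym: "(a, b) \<in> orient A R \<Longrightarrow> (b, a) \<notin> orient A R" for a b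
    using R A_asym by (auto simp: orient_def)
  moreover have "(a, a) \<notin> orient A R" for a using asym by blast
  ultimately have "pair_digraph (reorient R)"
    using D.pair_finite_verts by unfold_locales auto
  moreover have "asym (orient A R)" using asym by (rule asymI)
  moreover have "mk_symmetric (reorient R) = mk_symmetric D"
    using R by (auto simp: mk_symmetric_with_proj orient_def)
  ultimately show ?thesis
    using biclosed_imp_acyclic_orient[OF assms]
    by (simp add: AR_def reorientation_def simple_digraph_def)
qed

text \<open>Equal underlying graphs and asymmetry mean that \<open>E\<close> contains exactly one
  orientation of each arc of \<open>D\<close>. Thus \<open>AR D\<close> is the poset of biclosed
  sets under inclusion.\<close>

lemma AR_eq_reorient:
  assumes "E \<in> carrier (AR D)"
  shows "E = reorient (reversed_arcs D E)" and "biclosed A (reversed_arcs D E)"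
proof -
  let ?R = "reversed_arcs D E"
  have E: "mk_symmetric E = mk_symmetric D" "asym (parcs E)" "acyclic (parcs E)"
    using assms by (auto simp: AR_def reorientation_def simple_digraph_def)
  have verts: "pverts E = pverts D" using arg_cong[OF E(1), of pverts] by simp
  have "parcs E \<union> (parcs E)\<inverse> = A \<union> A\<inverse>"
    using arg_cong[OF E(1), of parcs] by (simp add: mk_symmetric_with_proj)
  then have sym: "(a, b) \<in> parcs E \<or> (b, a) \<in> parcs E \<longleftrightarrow> (a, b) \<in> A \<or> (b, a) \<in> A" for a b
    by blast
  have arcs: "parcs E = orient A ?R"
  proof -
    have "(a, b) \<in> parcs E \<longleftrightarrow> (a, b) \<in> orient A ?R" for a b
      using sym[of a b] asymD[OF E(2), of a b] A_asym[of a b]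
      unfolding orient_def reversed_arcs_def by blast
    then show ?thesis by (intro subset_antisym subrelI) blast+
  qed
  with verts show "E = reorient ?R" by (simp add: reorient_def)
  have "?R \<subseteq> A" by (auto simp: reversed_arcs_def)
  moreover from arcs E(3) have "acyclic (orient A ?R)" by (rule subst)
  ultimately show "biclosed A ?R" by (simp add: biclosed_iff)
qed

lemma le_AR [simp]: "E \<sqsubseteq>\<^bsub>AR D\<^esub> F \<longleftrightarrow> reversed_arcs D E \<subseteq> reversed_arcs D F"
  and eq_AR [simp]: "eq (AR D) = (=)"
  by (simp_all add: AR_def)

section \<open>Finiteness and lattice structure\<close>

lemma finite_AR: "finite (carrier (AR D))"
proof (rule finite_subset)
  show "carrier (AR D) \<subseteq> reorient ` Pow A"
    using AR_eq_reorient biclosed_subset by blast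
qed (use finite_A in simp)

lemma AR_partial_order: "partial_order (AR D)"
  by unfold_locales (auto, metis AR_eq_reorient(1) subset_antisym)

lemma AR_lattice: "lattice (AR D)"
proof -
  interpret partial_order "AR D" by (rule AR_partial_order)
  show ?thesis
  proof unfold_locales
    fix E F assume c: "E \<in> carrier (AR D)" "F \<in> carrier (AR D)"
    let ?R = "reversed_arcs D E" and ?S = "reversed_arcs D F"
    note bi = AR_eq_reorient(2)[OF c(1)] AR_eq_reorient(2)[OF c(2)]
    let ?U = "A \<inter> (?R \<union> ?S)\<^sup>+"
    have U: "biclosed A ?U" using bi by (rule biclosed_join)
    have "least (AR D) (reorient ?U) (Upper (AR D) {E, F})"
    proof (rule least_UpperI)
      fix G assume "G \<in> {E, F}"
      then show "G \<sqsubseteq>\<^bsub>AR D\<^esub> reorient ?U"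
        using biclosed_subset[OF bi(1)] biclosed_subset[OF bi(2)] by auto
    next
      fix G assume "G \<in> Upper (AR D) {E, F}"
      then have "G \<in> carrier (AR D)" "?R \<subseteq> reversed_arcs D G" "?S \<subseteq> reversed_arcs D G"
        using c by (auto simp: Upper_def)
      then show "reorient ?U \<sqsubseteq>\<^bsub>AR D\<^esub> G"
        using biclosed_join_least AR_eq_reorient(2) by simp
    qed (use c reorient_in_AR[OF U] in auto)
    then show "\<exists>G. least (AR D) G (Upper (AR D) {E, F})" by blast
    \<comment> \<open>The complement of the join of the complements.\<close>
    let ?V = "A - A \<inter> ((A - ?R) \<union> (A - ?S))\<^sup>+"
    have V: "biclosed A ?V" using bi by (intro biclosed_compl biclosed_join)
    have "greatest (AR D) (reorient ?V) (Lower (AR D) {E, F})"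
    proof (rule greatest_LowerI)
      fix G assume "G \<in> {E, F}"
      then show "reorient ?V \<sqsubseteq>\<^bsub>AR D\<^esub> G" by auto
    next
      fix G assume G: "G \<in> Lower (AR D) {E, F}"
      let ?T = "reversed_arcs D G"
      have T: "biclosed A ?T" "?T \<subseteq> ?R" "?T \<subseteq> ?S"
        using G c AR_eq_reorient(2) by (auto simp: Lower_def)
      then have "A \<inter> ((A - ?R) \<union> (A - ?S))\<^sup>+ \<subseteq> A - ?T"
        by (intro biclosed_join_least biclosed_compl) auto
      with biclosed_subset[OF T(1)] show "G \<sqsubseteq>\<^bsub>AR D\<^esub> reorient ?V" by auto
    qed (use c reorient_in_AR[OF V] in auto)
    then show "\<exists>G. greatest (AR D) G (Lower (AR D) {E, F})" by blast
  qed
qed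

sublocale AR: lattice "AR D"
  by (rule AR_lattice)

lemma join_reorient:
  assumes "biclosed A R" "biclosed A S" "biclosed A (R \<union> S)"
  shows "reorient R \<squnion>\<^bsub>AR D\<^esub> reorient S = reorient (R \<union> S)"
proof (rule AR.le_antisym)
  note c = assms[THEN reorient_in_AR] and sub = assms[THEN biclosed_subset]
  show "reorient R \<squnion>\<^bsub>AR D\<^esub> reorient S \<sqsubseteq>\<^bsub>AR D\<^esub> reorient (R \<union> S)"
    using c sub by (intro AR.join_le) auto
  show "reorient (R \<union> S) \<sqsubseteq>\<^bsub>AR D\<^esub> reorient R \<squnion>\<^bsub>AR D\<^esub> reorient S"
    using AR.join_left[OF c(1,2)] AR.join_right[OF c(1,2)] sub by simp
qed (use assms reorient_in_AR in auto)

lemma meet_reorient: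
  assumes "biclosed A R" "biclosed A S" "biclosed A (R \<inter> S)"
  shows "reorient R \<sqinter>\<^bsub>AR D\<^esub> reorient S = reorient (R \<inter> S)"
proof (rule AR.le_antisym)
  note c = assms[THEN reorient_in_AR] and sub = assms[THEN biclosed_subset]
  show "reorient (R \<inter> S) \<sqsubseteq>\<^bsub>AR D\<^esub> reorient R \<sqinter>\<^bsub>AR D\<^esub> reorient S"
    using c sub by (intro AR.meet_le) auto
  show "reorient R \<sqinter>\<^bsub>AR D\<^esub> reorient S \<sqsubseteq>\<^bsub>AR D\<^esub> reorient (R \<inter> S)"
    using AR.meet_left[OF c(1,2)] AR.meet_right[OF c(1,2)] sub by simp
qed (use assms reorient_in_AR in auto)


section \<open>Cover relations\<close>

lemma arcs_transitive_reduction_reorient: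
  assumes "biclosed A R"
  shows "arcs (transitive_reduction (with_proj (reorient R))) = cover_arcs (orient A R)"
proof -
  have "orient A R \<subseteq> pverts D \<times> pverts D"
    using biclosed_subset[OF assms] by (auto simp: orient_def dest: D.wellformed')
  then show ?thesis
    using biclosed_imp_acyclic_orient[OF assms] by (subst transitive_reduction_arcs) auto
qed

text \<open>Removing \<open>(u, v)\<close> from the reversed arcs flips \<open>(v, u)\<close> in the
  reorientation, which stays acyclic by \<open>flip_cover_arc\<close>.\<close>

lemma biclosed_remove_cover_arc:
  assumes R: "biclosed A R" and uv: "(u, v) \<in> A" "(v, u) \<in> cover_arcs (orient A R)"
  shows "(u, v) \<in> R" and "biclosed A (R - {(u, v)})"
proof -
  note RA = biclosed_subset[OF R]
  show "(u, v) \<in> R"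
    using uv cover_arcs_subset orient_rev_iff[OF RA] by blast
  moreover have "(u, v) \<in> X \<Longrightarrow> X \<subseteq> A \<Longrightarrow>
      orient A (X - {(u, v)}) = insert (u, v) (orient A X - {(v, u)})" for X
    using A_asym by (auto simp: orient_def)
  ultimately show "biclosed A (R - {(u, v)})"
    using flip_cover_arc(1)[OF biclosed_imp_acyclic_orient[OF R] uv(2)] RA
    by (auto simp: biclosed_iff)
qed

lemma biclosed_insert_cover_arc:
  assumes R: "biclosed A R" and uv: "(u, v) \<in> A" "(u, v) \<in> cover_arcs (orient A R)"
  shows "(u, v) \<notin> R" and "biclosed A (insert (u, v) R)"
    and "(v, u) \<in> cover_arcs (orient A (insert (u, v) R))"
proof -
  note RA = biclosed_subset[OF R]
  show "(u, v) \<notin> R"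
    using uv cover_arcs_subset orient_inter_iff[OF RA] by blast
  then have "orient A (insert (u, v) R) = insert (v, u) (orient A R - {(u, v)})"
    using RA uv(1) A_asym by (auto simp: orient_def)
  with flip_cover_arc[OF biclosed_imp_acyclic_orient[OF R] uv(2)] RA uv(1)
  show "biclosed A (insert (u, v) R)" "(v, u) \<in> cover_arcs (orient A (insert (u, v) R))"
    by (auto simp: biclosed_iff)
qed

text \<open>If every reversed cover arc of \<^term>\<open>orient A R\<close> is also reversed by \<open>S \<subseteq> R\<close>, then all cover
  arcs of \<^term>\<open>orient A R\<close> belong to the acyclic \<^term>\<open>orient A S\<close>, which forces equality.\<close>

lemma ex_cover_arc_diff:
  assumes R: "biclosed A R" and S: "biclosed A S" and "S \<subset> R"
  obtains u v where "(u, v) \<in> A" "(v, u) \<in> cover_arcs (orient A R)" "(u, v) \<in> R - S"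
proof (rule ccontr)
  assume neg: "\<not> thesis"
  note RA = biclosed_subset[OF R] and SA = biclosed_subset[OF S]
  have "cover_arcs (orient A R) \<subseteq> orient A S"
  proof (rule subrelI)
    fix a b assume ab: "(a, b) \<in> cover_arcs (orient A R)"
    then have "(a, b) \<in> orient A R" using cover_arcs_subset by blast
    with ab neg that[of b a] RA \<open>S \<subset> R\<close> show "(a, b) \<in> orient A S"
      by (auto simp: orient_def)
  qed
  moreover have "finite (orient A R)"
    using finite_A RA by (auto simp: orient_def intro: finite_subset)
  ultimately have sub: "(orient A R)\<^sup>+ \<subseteq> (orient A S)\<^sup>+"
    using trancl_cover_arcs[OF _ biclosed_imp_acyclic_orient[OF R]] trancl_mono_subset by metis
  obtain u v where uv: "(u, v) \<in> R" "(u, v) \<notin> S" using \<open>S \<subset> R\<close> by auto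
  with RA have "(v, u) \<in> orient A R" "(u, v) \<in> orient A S" by (auto simp: orient_def)
  with sub have "(u, u) \<in> (orient A S)\<^sup>+" by (meson r_into_trancl subsetD trancl_trans)
  with biclosed_imp_acyclic_orient[OF S] show False by (simp add: acyclic_def)
qed

lemma reorient_less_iff:
  "R \<subseteq> A \<Longrightarrow> S \<subseteq> A \<Longrightarrow> reorient R \<sqsubset>\<^bsub>AR D\<^esub> reorient S \<longleftrightarrow> R \<subset> S"
  using reversed_arcs_reorient by (auto simp: lless_def) (metis reversed_arcs_reorient)

text \<open>By \<open>ex_cover_arc_diff\<close>, a biclosed set strictly inside \<open>R\<close>
  misses some reversed cover arc, hence lies in \<open>R\<close> without that arc, which is biclosed
  again. Conversely, nothing fits between sets differing by one arc.\<close>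

lemma covers_reorient:
  assumes R: "biclosed A R"
  shows "covers (AR D) (reorient R) F \<longleftrightarrow>
    (\<exists>u v. (u, v) \<in> A \<and> (v, u) \<in> cover_arcs (orient A R) \<and> F = reorient (R - {(u, v)}))"
proof
  assume cov: "covers (AR D) (reorient R) F"
  define S where "S = reversed_arcs D F"
  have F: "F = reorient S" "biclosed A S"
    using cov AR_eq_reorient by (auto simp: covers_def S_def)
  with cov R have "S \<subset> R"
    using reorient_less_iff[OF biclosed_subset biclosed_subset] by (simp add: covers_def)
  with R F(2) obtain u v where uv: "(u, v) \<in> A" "(v, u) \<in> cover_arcs (orient A R)" "(u, v) \<in> R - S"
    by (rule ex_cover_arc_diff)
  let ?T = "R - {(u, v)}"
  have T: "biclosed A ?T" using biclosed_remove_cover_arc[OF R uv(1,2)] by blast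
  note sub = biclosed_subset[OF R] biclosed_subset[OF F(2)] biclosed_subset[OF T]
  have "\<not> S \<subset> ?T"
  proof
    assume "S \<subset> ?T"
    then have "F \<sqsubset>\<^bsub>AR D\<^esub> reorient ?T"
      unfolding F(1) reorient_less_iff[OF sub(2,3)] .
    moreover have "reorient ?T \<sqsubset>\<^bsub>AR D\<^esub> reorient R"
      unfolding reorient_less_iff[OF sub(3,1)] using uv(3) by blast
    ultimately show False using cov reorient_in_AR[OF T] unfolding covers_def by blast
  qed
  with \<open>S \<subset> R\<close> uv(3) have "S = ?T" by auto
  with F(1) uv show "\<exists>u v. (u, v) \<in> A \<and> (v, u) \<in> cover_arcs (orient A R) \<and> F = reorient (R - {(u, v)})"
    by blast
next
  assume "\<exists>u v. (u, v) \<in> A \<and> (v, u) \<in> cover_arcs (orient A R) \<and> F = reorient (R - {(u, v)})"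
  then obtain u v where uv: "(u, v) \<in> A" "(v, u) \<in> cover_arcs (orient A R)"
    and F: "F = reorient (R - {(u, v)})" by blast
  note rem = biclosed_remove_cover_arc[OF R uv]
  have "False" if G: "G \<in> carrier (AR D)" "F \<sqsubset>\<^bsub>AR D\<^esub> G" "G \<sqsubset>\<^bsub>AR D\<^esub> reorient R" for G
  proof -
    obtain T where T: "G = reorient T" "biclosed A T" using AR_eq_reorient[OF G(1)] by blast
    have "R - {(u, v)} \<subset> T" "T \<subset> R"
      using G(2,3) unfolding F T(1)
        reorient_less_iff[OF biclosed_subset[OF rem(2)] biclosed_subset[OF T(2)]]
        reorient_less_iff[OF biclosed_subset[OF T(2)] biclosed_subset[OF R]] by blast+
    then show False by auto
  qed
  moreover have "F \<sqsubset>\<^bsub>AR D\<^esub> reorient R"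
    using rem biclosed_subset[OF R] by (subst F, subst reorient_less_iff) auto
  ultimately show "covers (AR D) (reorient R) F"
    using reorient_in_AR[OF R] reorient_in_AR[OF rem(2)] F by (auto simp: covers_def)
qed

text \<open>This is \<open>covers_reorient\<close> seen from the lower element, since a flipped
  cover arc is again a cover arc.\<close>

lemma covers_reorient_up:
  assumes R: "biclosed A R"
  shows "covers (AR D) F (reorient R) \<longleftrightarrow>
    (\<exists>u v. (u, v) \<in> A \<and> (u, v) \<in> cover_arcs (orient A R) \<and> F = reorient (insert (u, v) R))"
proof
  assume cov: "covers (AR D) F (reorient R)"
  define S where "S = reversed_arcs D F"
  have F: "F = reorient S" "biclosed A S"
    using cov AR_eq_reorient by (auto simp: covers_def S_def)
  with cov obtain u v where uv: "(u, v) \<in> A" "(v, u) \<in> cover_arcs (orient A S)"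
    and eq: "reorient R = reorient (S - {(u, v)})"
    using covers_reorient by blast
  have "R = S - {(u, v)}"
    using arg_cong[OF eq, of "reversed_arcs D"] biclosed_subset[OF R] biclosed_subset[OF F(2)]
    by (simp add: subset_eq)
  moreover have uvS: "(u, v) \<in> S" using biclosed_remove_cover_arc[OF F(2) uv] by blast
  ultimately have S: "S = insert (u, v) R" "(u, v) \<notin> R" by auto
  have "orient A R = insert (u, v) (orient A S - {(v, u)})"
    using \<open>R = S - {(u, v)}\<close> uvS biclosed_subset[OF F(2)] A_asym by (auto simp: orient_def)
  then have "(u, v) \<in> cover_arcs (orient A R)"
    using flip_cover_arc(2)[OF biclosed_imp_acyclic_orient[OF F(2)] uv(2)] by simp
  with uv(1) S(1) F(1) show
    "\<exists>u v. (u, v) \<in> A \<and> (u, v) \<in> cover_arcs (orient A R) \<and> F = reorient (insert (u, v) R)" by blast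
next
  assume "\<exists>u v. (u, v) \<in> A \<and> (u, v) \<in> cover_arcs (orient A R) \<and> F = reorient (insert (u, v) R)"
  then obtain u v where uv: "(u, v) \<in> A" "(u, v) \<in> cover_arcs (orient A R)"
    and F: "F = reorient (insert (u, v) R)" by blast
  note ins = biclosed_insert_cover_arc[OF R uv]
  have "reorient R = reorient (insert (u, v) R - {(u, v)})" using ins(1) by simp
  with covers_reorient[OF ins(2)] uv(1) ins(3) F show "covers (AR D) F (reorient R)" by blast
qed


section \<open>Ropes and join irreducibles\<close>

text \<open>Filledness makes every interior vertex of a path from \<open>u\<close> to
  \<open>v\<close> a neighbour of both ends, so ropes can be handled through triangles
  alone.\<close>

lemma transitive_support_minus_ends:
  assumes uv: "(u, v) \<in> A"
  shows "transitive_support D u v - {u, v} = {w. (u, w) \<in> A \<and> (w, v) \<in> A}"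
proof (intro subset_antisym subsetI)
  fix w assume w: "w \<in> transitive_support D u v - {u, v}"
  then obtain p where p: "vwalk p D" "hd p = u" "last p = v" "w \<in> set p"
    by (auto simp: transitive_support_def dipath_def)
  then obtain i where i: "i < length p" "p ! i = w" by (auto simp: in_set_conv_nth)
  have ends: "p ! 0 = u" "p ! (length p - 1) = v"
    using p by (auto simp: hd_conv_nth last_conv_nth vwalk_def)
  with w i have "i \<noteq> 0" "i \<noteq> length p - 1" by (metis DiffD2 insertCI)+
  with i ends vwalk_nth_trancl[OF p(1), of 0 i] vwalk_nth_trancl[OF p(1), of i "length p - 1"]
  have "(u, w) \<in> A\<^sup>+" "(w, v) \<in> A\<^sup>+" by auto
  with A_between[OF uv] show "w \<in> {w. (u, w) \<in> A \<and> (w, v) \<in> A}" by blast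
next
  fix w assume w: "w \<in> {w. (u, w) \<in> A \<and> (w, v) \<in> A}"
  obtain p k where "dipath D u p v" "Suc k < length p" "p ! k = w"
    by (rule acyclic_dipath_through[of D u w v])
      (use w acyclic_A in \<open>auto dest: D.wellformed'\<close>)
  then have "w \<in> transitive_support D u v"
    unfolding transitive_support_def by (auto intro!: exI[of _ p] nth_mem)
  with w A_irrefl show "w \<in> transitive_support D u v - {u, v}" by auto
qed

lemma ropes_iff:
  "(u, v, N, T) \<in> ropes D \<longleftrightarrow>
     (u, v) \<in> A \<and> N \<inter> T = {} \<and> N \<union> T = {w. (u, w) \<in> A \<and> (w, v) \<in> A}"
  by (cases "(u, v) \<in> A") (simp_all add: ropes_def transitive_support_minus_ends)

lemma arc_rope_reorient:
  assumes "R \<subseteq> A"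
  shows "arc_rope D (reorient R) u v =
    (u, v, {w. (u, w) \<in> R \<and> (w, v) \<in> A - R}, {w. (u, w) \<in> A - R \<and> (w, v) \<in> R})"
  unfolding arc_rope_def rope_nabla_def rope_delta_def parcs_reorient
    orient_diff_iff[OF assms] orient_inter_iff[OF assms]
  using assms D.wellformed' by blast

text \<open>For \<open>w\<close> between \<open>u\<close> and \<open>v\<close>, biclosedness forces
  one of \<open>(u, w)\<close>, \<open>(w, v)\<close> to be reversed along with
  \<open>(u, v)\<close>; if both were, the path through \<open>w\<close> would make
  \<open>(v, u)\<close> redundant.\<close>

lemma arc_rope_in_ropes:
  assumes R: "biclosed A R" and uv: "(u, v) \<in> A"
    and cov: "(v, u) \<in> cover_arcs (orient A R)"
  shows "arc_rope D (reorient R) u v \<in> ropes D"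
proof -
  note RA = biclosed_subset[OF R]
  have uvR: "(u, v) \<in> R" using biclosed_remove_cover_arc[OF R uv cov] by blast
  have "(u, w) \<in> R \<longleftrightarrow> (w, v) \<notin> R" if w: "(u, w) \<in> A" "(w, v) \<in> A" for w
  proof -
    have "\<not> ((u, w) \<in> R \<and> (w, v) \<in> R)"
      using cov unfolding cover_arcs_def orient_def by blast
    with biclosedD(2)[OF R w uv uvR] show ?thesis by blast
  qed
  with RA show ?thesis
    unfolding arc_rope_reorient[OF RA] ropes_iff using uv by auto
qed

text \<open>The reversed arcs of the join irreducible encoded by a rope. Since \<^const>\<open>rope_nabla\<close> is
  computed from the arcs of the reoriented graph, its elements \<open>w\<close> are those for which \<open>(u, w)\<close> is
  reversed and \<open>(w, v)\<close> is not.\<close>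

fun rope_arcs :: "'a rope \<Rightarrow> ('a \<times> 'a) set" where
  "rope_arcs (u, v, N, T) = {(a, b) \<in> A. a \<in> insert u T \<and> b \<in> insert v N}"

text \<open>For \<open>a\<close> in the delta part and \<open>b\<close> in the nabla part,
  \<open>(a, v)\<close> is in \<open>R\<close> and \<open>(b, v)\<close> is not, so splitting
  \<open>(a, v)\<close> at \<open>b\<close> puts \<open>(a, b)\<close> into
  \<open>R\<close>.\<close>

lemma rope_arcs_subset:
  assumes R: "biclosed A R" and uv: "(u, v) \<in> R"
  shows "rope_arcs (arc_rope D (reorient R) u v) \<subseteq> R"
  unfolding arc_rope_reorient[OF biclosed_subset[OF R]] rope_arcs.simps
  using biclosed_subset[OF R] biclosedD(2)[OF R] uv by auto

section \<open>The join irreducible of a fixed rope\<close>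

context
  fixes u v :: 'a and N T :: "'a set"
  assumes rope: "(u, v, N, T) \<in> ropes D"
begin

abbreviation J :: "('a \<times> 'a) set" where "J \<equiv> rope_arcs (u, v, N, T)"

lemma uv_A: "(u, v) \<in> A" and disj: "N \<inter> T = {}"
  and between: "N \<union> T = {w. (u, w) \<in> A \<and> (w, v) \<in> A}"
  using rope by (simp_all add: ropes_iff)

lemma uv_J: "(u, v) \<in> J"
  using uv_A by simp

lemma J_between:
  assumes "(a, b) \<in> J" and "(a, c) \<in> A" and "(c, b) \<in> A"
  shows "c \<in> N \<union> T"
proof -
  have "a = u \<or> (u, a) \<in> A" "b = v \<or> (b, v) \<in> A" using assms(1) between by auto
  with assms have "(u, c) \<in> A\<^sup>+" "(c, v) \<in> A\<^sup>+" by (auto intro: trancl_into_trancl2)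
  with A_between[OF uv_A] show ?thesis unfolding between by blast
qed

text \<open>Arcs of \<open>J\<close> start in \<open>insert u T\<close> and end in the disjoint set
  \<open>insert v N\<close>, so triangle closure of \<open>J\<close> and its subsets is
  vacuous.\<close>

lemma J_not_composable:
  assumes "(a, c) \<in> J" and "(c, b) \<in> J"
  shows False
proof -
  have "c \<in> insert v N" "c \<in> insert u T" using assms by auto
  moreover have "v \<notin> T" "u \<notin> N" "u \<noteq> v" using between uv_A A_irrefl by auto
  ultimately show False using disj by auto
qed

text \<open>An arc of \<open>J\<close> is split at \<open>c\<close> by \<open>(a, c)\<close> if
  \<open>c\<close> is in \<open>N\<close> and by \<open>(c, b)\<close> if \<open>c\<close> is in
  \<open>T\<close>. Neither of these is \<open>(u, v)\<close>, so the argument serves both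
  sets.\<close>

lemma biclosed_J: "biclosed A J" and biclosed_J_star: "biclosed A (J - {(u, v)})"
proof -
  have "(a, c) \<in> J - {(u, v)} \<or> (c, b) \<in> J - {(u, v)}"
    if ab: "(a, b) \<in> J" and c: "(a, c) \<in> A" "(c, b) \<in> A" for a b c
  proof -
    have "c \<noteq> u" "c \<noteq> v" using J_between[OF ab c] between A_irrefl by auto
    with J_between[OF ab c] ab c show ?thesis by auto
  qed
  moreover have "J \<subseteq> A" by auto
  ultimately show "biclosed A J" "biclosed A (J - {(u, v)})"
    using J_not_composable unfolding biclosed_def by blast+
qed

text \<open>The arc \<open>(u, v)\<close> generates \<open>J\<close>: splitting it at
  \<open>a\<close> in \<open>T\<close> forces \<open>(a, v)\<close>, splitting it at
  \<open>b\<close> in \<open>N\<close> forces \<open>(u, b)\<close>, and splitting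
  \<open>(a, v)\<close> at \<open>b\<close> forces \<open>(a, b)\<close>; the other halves lie
  outside \<open>J\<close>.\<close>

lemma biclosed_below_J:
  assumes S: "biclosed A S" and "S \<subseteq> J" and uv: "(u, v) \<in> S"
  shows "S = J"
proof -
  have ne: "(a, v) \<in> S" if "a \<in> T" for a
  proof -
    have "(u, a) \<in> A" "(a, v) \<in> A" "a \<notin> N" "a \<noteq> v" using that between disj A_irrefl by auto
    with biclosedD(2)[OF S _ _ uv_A uv, of a] \<open>S \<subseteq> J\<close> show ?thesis by auto
  qed
  have nb: "(u, b) \<in> S" if "b \<in> N" for b
  proof -
    have "(u, b) \<in> A" "(b, v) \<in> A" "b \<notin> T" "b \<noteq> u" using that between disj A_irrefl by auto
    with biclosedD(2)[OF S _ _ uv_A uv, of b] \<open>S \<subseteq> J\<close> show ?thesis by auto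
  qed
  have "(a, b) \<in> S" if "a \<in> T" "b \<in> N" "(a, b) \<in> A" for a b
  proof -
    have "(b, v) \<in> A" "(a, v) \<in> A" "b \<notin> T" "b \<noteq> u" using that between disj A_irrefl by auto
    with biclosedD(2)[OF S that(3)] ne[OF that(1)] \<open>S \<subseteq> J\<close> show ?thesis by auto
  qed
  with ne nb uv have "J \<subseteq> S" by auto
  with \<open>S \<subseteq> J\<close> show ?thesis by blast
qed

text \<open>Removing any other reversed cover arc would leave a smaller biclosed set containing
  \<open>(u, v)\<close>, against \<open>biclosed_below_J\<close>. That \<open>(u, v)\<close> does
  occur follows by comparing \<open>J\<close> with \<open>J - {(u, v)}\<close>.\<close>

lemma cover_arc_J:
  "(a, b) \<in> A \<and> (b, a) \<in> cover_arcs (orient A J) \<longleftrightarrow> a = u \<and> b = v"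
proof
  assume ab: "(a, b) \<in> A \<and> (b, a) \<in> cover_arcs (orient A J)"
  then have "(a, b) \<in> J" "biclosed A (J - {(a, b)})"
    using biclosed_remove_cover_arc[OF biclosed_J] by blast+
  then have "(u, v) \<notin> J - {(a, b)}"
    using biclosed_below_J[of "J - {(a, b)}"] by blast
  with uv_J show "a = u \<and> b = v" by blast
next
  assume "a = u \<and> b = v"
  moreover obtain a' b' where "(a', b') \<in> A" "(b', a') \<in> cover_arcs (orient A J)"
    "(a', b') \<in> J - (J - {(u, v)})"
    using ex_cover_arc_diff[OF biclosed_J biclosed_J_star] uv_J by blast
  ultimately show "(a, b) \<in> A \<and> (b, a) \<in> cover_arcs (orient A J)" by auto
qed

lemma covers_J: "covers (AR D) (reorient J) F \<longleftrightarrow> F = reorient (J - {(u, v)})"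
  unfolding covers_reorient[OF biclosed_J] using cover_arc_J by metis

lemma join_irreducible_J: "join_irreducible (AR D) (reorient J)"
  unfolding join_irreducible_def covers_J using reorient_in_AR[OF biclosed_J] by blast

lemma lower_cover_J: "lower_cover (AR D) (reorient J) = reorient (J - {(u, v)})"
  unfolding lower_cover_def covers_J by (rule the_eq_trivial)

lemma join_rope_J: "join_rope D (reorient J) = (u, v, N, T)"
proof -
  have "{w. (u, w) \<in> J \<and> (w, v) \<in> A - J} = N"
    using between disj A_irrefl by auto
  moreover have "{w. (u, w) \<in> A - J \<and> (w, v) \<in> J} = T"
    using between disj A_irrefl by auto
  ultimately have "arc_rope D (reorient J) u v = (u, v, N, T)"
    using arc_rope_reorient[OF biclosed_subset[OF biclosed_J]] by simp
  moreover have "join_ropes D (reorient J) = {arc_rope D (reorient J) u v}"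
    unfolding join_ropes_def arcs_transitive_reduction_reorient[OF biclosed_J] cover_arc_J by auto
  ultimately show ?thesis by (simp add: join_rope_def)
qed

end

text \<open>Lower covers correspond to reversed cover arcs, so \<open>K\<close> has just one,
  \<open>(u, v)\<close>. If the arcs of its rope were a proper subset of those reversed in
  \<open>K\<close>, \<open>ex_cover_arc_diff\<close> would give a second one.\<close>

lemma join_irreducible_eq:
  assumes "join_irreducible (AR D) K"
  shows "K = reorient (rope_arcs (join_rope D K))"
proof -
  obtain R where K: "K = reorient R" and R: "biclosed A R"
    using assms AR_eq_reorient by (auto simp: join_irreducible_def)
  have ex1: "\<exists>!F. covers (AR D) (reorient R) F" using assms K by (auto simp: join_irreducible_def)
  then obtain u v where uv: "(u, v) \<in> A" "(v, u) \<in> cover_arcs (orient A R)"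
    unfolding covers_reorient[OF R] by blast
  have uniq: "a = u \<and> b = v" if ab: "(a, b) \<in> A" "(b, a) \<in> cover_arcs (orient A R)" for a b
  proof -
    have "reorient (R - {(a, b)}) = reorient (R - {(u, v)})"
      using ex1 ab uv unfolding covers_reorient[OF R] by blast
    then have "R - {(a, b)} = R - {(u, v)}"
      using biclosed_subset[OF R] by (metis Diff_subset reversed_arcs_reorient subset_trans)
    moreover have "(a, b) \<in> R" "(u, v) \<in> R"
      using biclosed_remove_cover_arc(1)[OF R] ab uv by blast+
    ultimately show ?thesis by blast
  qed
  define \<rho> where "\<rho> = arc_rope D (reorient R) u v"
  have "join_ropes D (reorient R) = {\<rho>}"
    unfolding join_ropes_def arcs_transitive_reduction_reorient[OF R] \<rho>_def using uv uniq by blast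
  then have \<rho>: "join_rope D K = \<rho>" by (simp add: join_rope_def K)
  obtain N T where NT: "\<rho> = (u, v, N, T)" by (simp add: \<rho>_def arc_rope_def)
  have rope: "(u, v, N, T) \<in> ropes D"
    using arc_rope_in_ropes[OF R uv] NT \<rho>_def by simp
  have "rope_arcs \<rho> \<subseteq> R"
    unfolding \<rho>_def using R biclosed_remove_cover_arc(1)[OF R uv] by (rule rope_arcs_subset)
  moreover have "\<not> rope_arcs \<rho> \<subset> R"
  proof
    assume "rope_arcs \<rho> \<subset> R"
    then obtain a b where "(a, b) \<in> A" "(b, a) \<in> cover_arcs (orient A R)" "(a, b) \<in> R - rope_arcs \<rho>"
      using ex_cover_arc_diff[OF R biclosed_J[OF rope]] unfolding NT by metis
    with uniq uv_J[OF rope] show False unfolding NT by blast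
  qed
  ultimately show ?thesis using K \<rho> by auto
qed

end


section \<open>Minimal and maximal elements of congruence classes\<close>

locale skeletal_congruence = skeletal_dag D for D :: "'a pair_pre_digraph" +
  fixes r :: "('a pair_pre_digraph \<times> 'a pair_pre_digraph) set"
  assumes congruence_r: "lattice_congruence (AR D) r"
begin

sublocale AR: finite_lattice_congruence "AR D" r
  by unfold_locales (use finite_AR congruence_r in auto)

text \<open>By \<open>join_irreducible_eq\<close> only one join irreducible has the given rope, so
  the existential in \<open>uncontracted_ropes\<close> reduces to that one.\<close>

lemma uncontracted_rope_iff:
  assumes rope: "(u, v, N, T) \<in> ropes D"
  shows "(u, v, N, T) \<in> uncontracted_ropes D r \<longleftrightarrow>
    (reorient (rope_arcs (u, v, N, T) - {(u, v)}), reorient (rope_arcs (u, v, N, T))) \<notin> r"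
    (is "?\<rho> \<in> _ \<longleftrightarrow> _")
proof -
  have "?\<rho> \<in> uncontracted_ropes D r \<longleftrightarrow> \<not> contracted (AR D) r (reorient (rope_arcs ?\<rho>))"
    unfolding uncontracted_ropes_def mem_Collect_eq
    using rope join_irreducible_J[OF rope] join_rope_J[OF rope] join_irreducible_eq by metis
  then show ?thesis unfolding contracted_def lower_cover_J[OF rope] .
qed

lemma arc_rope_uncontracted_iff:
  assumes R: "biclosed A R" and uv: "(u, v) \<in> A" "(v, u) \<in> cover_arcs (orient A R)"
  shows "arc_rope D (reorient R) u v \<in> uncontracted_ropes D r \<longleftrightarrow>
    (reorient (R - {(u, v)}), reorient R) \<notin> r"
proof -
  obtain N T where NT: "arc_rope D (reorient R) u v = (u, v, N, T)" by (simp add: arc_rope_def)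
  have rope: "(u, v, N, T) \<in> ropes D" using arc_rope_in_ropes[OF R uv] NT by simp
  let ?J = "rope_arcs (u, v, N, T)" and ?S = "R - {(u, v)}"
  note rem = biclosed_remove_cover_arc[OF R uv]
  have JR: "?J \<subseteq> R" using rope_arcs_subset[OF R rem(1)] NT by simp
  note bi = R rem(2) biclosed_J[OF rope] biclosed_J_star[OF rope]
  note sub = bi[THEN biclosed_subset]
  \<comment> \<open>Union and intersection are biclosed already, so they give the join and the meet,
    and the two cover pairs are perspective.\<close>
  have union: "?S \<union> ?J = R" and inter: "?S \<inter> ?J = ?J - {(u, v)}"
    using JR uv_J[OF rope] by auto
  have "(reorient (?J - {(u, v)}), reorient ?J) \<in> r \<longleftrightarrow> (reorient ?S, reorient R) \<in> r"
  proof (rule AR.perspective_contracted)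
    show "reorient ?S \<squnion>\<^bsub>AR D\<^esub> reorient ?J = reorient R"
      using join_reorient[OF bi(2,3)] bi(1) by (simp only: union)
    show "reorient ?S \<sqinter>\<^bsub>AR D\<^esub> reorient ?J = reorient (?J - {(u, v)})"
      using meet_reorient[OF bi(2,3)] bi(4) by (simp only: inter)
    show "reorient ?S \<sqsubseteq>\<^bsub>AR D\<^esub> reorient R" using sub by simp
    show "reorient ?J \<sqsubseteq>\<^bsub>AR D\<^esub> reorient R"
      unfolding le_AR reversed_arcs_reorient[OF sub(1)] reversed_arcs_reorient[OF sub(3)] by (rule JR)
    show "reorient (?J - {(u, v)}) \<sqsubseteq>\<^bsub>AR D\<^esub> reorient ?S"
      unfolding le_AR reversed_arcs_reorient[OF sub(2)] reversed_arcs_reorient[OF sub(4)]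
      using JR by blast
  qed (use bi reorient_in_AR in blast)+
  with uncontracted_rope_iff[OF rope] NT show ?thesis by simp
qed

lemma arc_rope_uncontracted_iff_up:
  assumes R: "biclosed A R" and uv: "(u, v) \<in> A" "(u, v) \<in> cover_arcs (orient A R)"
  shows "arc_rope D (reorient R) u v \<in> uncontracted_ropes D r \<longleftrightarrow>
    (reorient R, reorient (insert (u, v) R)) \<notin> r"
proof -
  let ?S = "insert (u, v) R"
  note ins = biclosed_insert_cover_arc[OF R uv]
  \<comment> \<open>Membership of \<open>(u, v)\<close> matters only for the candidates
    \<open>w = u\<close> and \<open>w = v\<close>, which would require a loop.\<close>
  have "arc_rope D (reorient ?S) u v = arc_rope D (reorient R) u v"
    unfolding arc_rope_reorient[OF biclosed_subset[OF R]]
      arc_rope_reorient[OF biclosed_subset[OF ins(2)]]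
    using A_irrefl biclosed_subset[OF R] by auto
  moreover have "?S - {(u, v)} = R" using ins(1) by simp
  ultimately show ?thesis using arc_rope_uncontracted_iff[OF ins(2) uv(1) ins(3)] by simp
qed

lemma minimal_iff:
  assumes "E \<in> carrier (AR D)"
  shows "minimal_in_class (AR D) r E \<longleftrightarrow> join_ropes D E \<subseteq> uncontracted_ropes D r"
proof -
  obtain R where E: "E = reorient R" and R: "biclosed A R" using AR_eq_reorient[OF assms] by blast
  show ?thesis
    unfolding AR.minimal_iff_no_contracted_cover[OF assms] unfolding E covers_reorient[OF R]
      join_ropes_def arcs_transitive_reduction_reorient[OF R]
    using arc_rope_uncontracted_iff[OF R] by blast
qed

lemma maximal_iff:
  assumes "E \<in> carrier (AR D)"
  shows "maximal_in_class (AR D) r E \<longleftrightarrow> meet_ropes D E \<subseteq> uncontracted_ropes D r"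
proof -
  obtain R where E: "E = reorient R" and R: "biclosed A R" using AR_eq_reorient[OF assms] by blast
  show ?thesis
    unfolding AR.maximal_iff_no_contracted_cover[OF assms] unfolding E covers_reorient_up[OF R]
      meet_ropes_def arcs_transitive_reduction_reorient[OF R]
    using arc_rope_uncontracted_iff_up[OF R] by blast
qed

end

theorem corollary39:
  fixes D :: "'a pair_pre_digraph"
    and r :: "('a pair_pre_digraph \<times> 'a pair_pre_digraph) set"
  assumes "dag D" and "skeletal D" and "lattice_congruence (AR D) r"
  shows "(\<forall>E \<in> carrier (AR D).
            minimal_in_class (AR D) r E \<longleftrightarrow> join_ropes D E \<subseteq> uncontracted_ropes D r) \<and>
         poset_isomorphic (quotient_poset (AR D) r)
           (subposet (AR D) {E \<in> carrier (AR D). join_ropes D E \<subseteq> uncontracted_ropes D r}) \<and>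
         (\<forall>E \<in> carrier (AR D).
            maximal_in_class (AR D) r E \<longleftrightarrow> meet_ropes D E \<subseteq> uncontracted_ropes D r) \<and>
         poset_isomorphic (quotient_poset (AR D) r)
           (subposet (AR D) {E \<in> carrier (AR D). meet_ropes D E \<subseteq> uncontracted_ropes D r})"
proof -
  interpret skeletal_congruence D r
    using assms by unfold_locales
  have "{E \<in> carrier (AR D). minimal_in_class (AR D) r E} =
      {E \<in> carrier (AR D). join_ropes D E \<subseteq> uncontracted_ropes D r}"
    and "{E \<in> carrier (AR D). maximal_in_class (AR D) r E} =
      {E \<in> carrier (AR D). meet_ropes D E \<subseteq> uncontracted_ropes D r}"
    using minimal_iff maximal_iff by blast+
  with minimal_iff maximal_iff AR.quotient_iso_minimal AR.quotient_iso_maximal show ?thesis by simp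
qed

end
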